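(* Let $\Omega=(-1,1)$ and let $f_I,g_I\in\mathcal S(\Omega)$ be nonnegative on $\Omega$. Let $m_f=\int_\Omega f_I\,dx$ and $m_g=\int_\Omega g_I\,dx$. For $\varepsilon>0$ let $(h_\varepsilon,u_\varepsilon)$ be the solution of $$h_t-h_{xx}=0,\qquad u_t-u_{xx}=\frac1{2\varepsilon}(h^2-u^2)_x\qquad (x\in\Omega,\ t>0),$$ with no-flux boundary conditions $h_x=0$ and $-u_x=\frac1{2\varepsilon}(h^2-u^2)$ at $x=\pm1$ and initial data $h(x,0)=f_I(x)+g_I(x)$, $u(x,0)=f_I(x)-g_I(x)$. Then there exist unique limiting functions $(u,h)$ of $(u_\varepsilon,h_\varepsilon)$ as $\varepsilon\to0$ (in $L^2(\Omega\times(0,T))$ for every $T>0$). Here $h=h(x,t)$ is the solution of the heat equation $h_t=h_{xx}$ on $\Omega$ with homogeneous Neumann boundary conditions and initial datum $f_I+g_I$, and $$u(x,t)=\begin{cases}h(x,t) & \text{for } x<p(t),\\ -h(x,t) & \text{for } x>p(t),\end{cases}$$ where, for $t>0$, $p(t)\in[-1,1]$ is determined by $$m_f=\int_{-1}^{p(t)}h(x,t)\,dx,\qquad\text{or, equivalently,}\qquad m_g=\int_{p(t)}^{1}h(x,t)\,dx.$$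
   Context: $\mathcal S(\Omega)$, for the bounded interval $\Omega=(-1,1)$, denotes smooth functions on $\Omega$ all of whose derivatives are bounded (i.e. smooth up to the boundary). The solution $(h_\varepsilon,u_\varepsilon)$ is the classical solution, smooth for $t>0$ up to $x=\pm1$ and attaining the initial data continuously as $t\downarrow0$; $h_\varepsilon$ does not depend on $\varepsilon$. In the model, $f=(h+u)/2$ and $g=(h-u)/2$ are the densities of buyers and vendors, $m_f$ and $m_g$ are their masses, and $p(t)$ is the price. *)

theory Defs
  imports "HOL-Analysis.Analysis"
begin

abbreviation Omega :: "real set" where
  "Omega \<equiv> {-1<..<1}"

text \<open>Smooth functions on \<open>(-1, 1)\<close> with all derivatives bounded.  As the interval is open,
  \<^term>\<open>(deriv ^^ k) f\<close> on it does not depend on the values of \<^term>\<open>f\<close> elsewhere.\<close>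

definition S_Omega :: "(real \<Rightarrow> real) set" where
  "S_Omega = {f. \<forall>k. (\<forall>x\<in>Omega. (deriv ^^ k) f field_differentiable (at x)) \<and>
                     bounded ((deriv ^^ k) f ` Omega)}"

text \<open>Functions of space and time are curried, space first.  The spatial derivative is taken within
  \<open>[-1, 1]\<close>, so it is the usual derivative inside and the one-sided one at \<open>x = -1\<close> and \<open>x = 1\<close>.\<close>

definition pd_x :: "(real \<Rightarrow> real \<Rightarrow> real) \<Rightarrow> real \<Rightarrow> real \<Rightarrow> real" where
  "pd_x w x t = vector_derivative (\<lambda>y. w y t) (at x within {-1..1})"

definition pd_t :: "(real \<Rightarrow> real \<Rightarrow> real) \<Rightarrow> real \<Rightarrow> real \<Rightarrow> real" where
  "pd_t w x t = vector_derivative (\<lambda>s. w x s) (at t)"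

primrec Ck_up_to_boundary :: "nat \<Rightarrow> (real \<Rightarrow> real \<Rightarrow> real) \<Rightarrow> bool" where
  "Ck_up_to_boundary 0 w \<longleftrightarrow> continuous_on ({-1..1} \<times> {0<..}) (\<lambda>(x, t). w x t)"
| "Ck_up_to_boundary (Suc k) w \<longleftrightarrow>
     continuous_on ({-1..1} \<times> {0<..}) (\<lambda>(x, t). w x t) \<and>
     (\<forall>x\<in>{-1..1}. \<forall>t>0. (\<lambda>y. w y t) differentiable (at x within {-1..1}) \<and>
                          (\<lambda>s. w x s) differentiable (at t)) \<and>
     Ck_up_to_boundary k (pd_x w) \<and> Ck_up_to_boundary k (pd_t w)"

text \<open>Smooth on \<open>[-1, 1] \<times> (0, \<infinity>)\<close>, and continuous down to \<open>t = 0\<close> with initial datum \<open>w0\<close>.  The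
  datum is only prescribed on the open interval; its values at \<open>x = -1\<close> and \<open>x = 1\<close> are those of its
  continuous extension.\<close>

definition classical_with_datum :: "(real \<Rightarrow> real) \<Rightarrow> (real \<Rightarrow> real \<Rightarrow> real) \<Rightarrow> bool" where
  "classical_with_datum w0 w \<longleftrightarrow>
     (\<forall>k. Ck_up_to_boundary k w) \<and>
     continuous_on ({-1..1} \<times> {0..}) (\<lambda>(x, t). w x t) \<and>
     (\<forall>x\<in>Omega. w x 0 = w0 x)"

definition heat_neumann_solution :: "(real \<Rightarrow> real) \<Rightarrow> (real \<Rightarrow> real \<Rightarrow> real) \<Rightarrow> bool" where
  "heat_neumann_solution h0 h \<longleftrightarrow>
     classical_with_datum h0 h \<and>
     (\<forall>x\<in>Omega. \<forall>t>0. pd_t h x t - pd_x (pd_x h) x t = 0) \<and>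
     (\<forall>x\<in>{-1, 1}. \<forall>t>0. pd_x h x t = 0)"

definition system_solution ::
  "real \<Rightarrow> (real \<Rightarrow> real) \<Rightarrow> (real \<Rightarrow> real) \<Rightarrow> (real \<Rightarrow> real \<Rightarrow> real) \<Rightarrow> (real \<Rightarrow> real \<Rightarrow> real) \<Rightarrow> bool" where
  "system_solution \<epsilon> fI gI h u \<longleftrightarrow>
     heat_neumann_solution (\<lambda>x. fI x + gI x) h \<and>
     classical_with_datum (\<lambda>x. fI x - gI x) u \<and>
     (\<forall>x\<in>Omega. \<forall>t>0. pd_t u x t - pd_x (pd_x u) x t
        = 1 / (2 * \<epsilon>) * pd_x (\<lambda>y s. (h y s)\<^sup>2 - (u y s)\<^sup>2) x t) \<and>
     (\<forall>x\<in>{-1, 1}. \<forall>t>0. - pd_x u x t = 1 / (2 * \<epsilon>) * ((h x t)\<^sup>2 - (u x t)\<^sup>2))"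

definition square_integrable_on :: "('a::euclidean_space) set \<Rightarrow> ('a \<Rightarrow> real) \<Rightarrow> bool" where
  "square_integrable_on A w \<longleftrightarrow>
     set_borel_measurable lebesgue A w \<and> set_integrable lebesgue A (\<lambda>z. (w z)\<^sup>2)"

text \<open>Square integrability of the family and of its limit is required explicitly because the Bochner
  integral of a non-integrable function is \<open>0\<close>.\<close>

definition L2_tendsto ::
  "('a::euclidean_space) set \<Rightarrow> ('e \<Rightarrow> 'a \<Rightarrow> real) \<Rightarrow> ('a \<Rightarrow> real) \<Rightarrow> 'e filter \<Rightarrow> bool" where
  "L2_tendsto A w l F \<longleftrightarrow>
     (\<forall>\<^sub>F e in F. square_integrable_on A (w e)) \<and> square_integrable_on A l \<and>
     ((\<lambda>e. set_lebesgue_integral lebesgue A (\<lambda>z. (w e z - l z)\<^sup>2)) \<longlongrightarrow> 0) F"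

text \<open>Convergence as \<open>\<epsilon> \<down> 0\<close> in \<open>L\<^sup>2(\<Omega> \<times> (0, T))\<close> for every \<open>T > 0\<close>.\<close>

definition vanishing_limit ::
  "(real \<Rightarrow> real \<Rightarrow> real \<Rightarrow> real) \<Rightarrow> (real \<Rightarrow> real \<Rightarrow> real) \<Rightarrow> bool" where
  "vanishing_limit w l \<longleftrightarrow>
     (\<forall>T>0. L2_tendsto (Omega \<times> {0<..<T}) (\<lambda>\<epsilon> (x, t). w \<epsilon> x t) (\<lambda>(x, t). l x t) (at_right 0))"

definition ae_equal :: "(real \<Rightarrow> real \<Rightarrow> real) \<Rightarrow> (real \<Rightarrow> real \<Rightarrow> real) \<Rightarrow> bool" where
  "ae_equal v w \<longleftrightarrow> (AE z in lebesgue. z \<in> Omega \<times> {0<..} \<longrightarrow> v (fst z) (snd z) = w (fst z) (snd z))"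

end

theory Submission
  imports Defs
begin

text \<open>The idea is to pass to cumulative masses.  Let \<open>f = (h + u) / 2\<close> and \<open>g = (h - u) / 2\<close>, and let
\<open>F\<close>, \<open>G\<close>, \<open>H\<close> be the integrals of \<open>f\<close>, \<open>g\<close>, \<open>h\<close> over \<open>(-1, x)\<close>.  By the no-flux conditions the total
masses are conserved, and integrating the equations in \<open>x\<close> gives

\<^item> \<open>H\<^sub>t = H\<^sub>x\<^sub>x\<close>
\<^item> \<open>F\<^sub>t = F\<^sub>x\<^sub>x + F\<^sub>x (h - F\<^sub>x) / \<epsilon>\<close>
\<^item> \<open>G\<^sub>t = G\<^sub>x\<^sub>x - G\<^sub>x (h - G\<^sub>x) / \<epsilon>\<close>

with Dirichlet conditions that do not depend on time.  Each of these equations preserves monotonicity in \<open>x\<close>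
(\<open>heat_drift_preserves_monotone\<close>), which yields \<open>h, f, g \<ge> 0\<close>, and, applied to differences, uniqueness
for the heat equation.

The Hopf-Cole transform \<open>W = e\<^bsup>-F/\<epsilon>\<^esup>\<close> solves the linear equation
\<open>W\<^sub>t = W\<^sub>x\<^sub>x + (h / \<epsilon>) W\<^sub>x\<close>, and so do the constants and \<open>e\<^bsup>-H/\<epsilon>\<^esup>\<close>.  Comparison
(\<open>hopf_cole_upper_bound\<close>) gives \<open>W \<le> e\<^bsup>-H/\<epsilon>\<^esup> + e\<^bsup>-m/\<epsilon>\<^esup>\<close> up to a transient which, thanks to the strict
positivity of \<open>h\<close> for \<open>t > 0\<close> (\<open>h_positive\<close>), is negligible after an arbitrarily short time;
here \<open>m\<close> is the mass of the buyers.  Taking logarithms, \<open>F \<ge> min(H, m) - \<epsilon> ln 3\<close>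
(\<open>primitive_f_lower_bound\<close>).

At the price \<open>p\<close> one has \<open>H(p) = m\<close>, so at most the mass \<open>\<epsilon> ln 3\<close> of vendors lies left of \<open>p\<close> and
the same mass of buyers lies right of it.  As \<open>f\<close> and \<open>g\<close> are bounded by \<open>h\<close>, this small misplaced
mass controls the squared distance between \<open>u\<close> and the profile that equals \<open>h\<close> left of \<open>p\<close> and
\<open>- h\<close> right of \<open>p\<close> (\<open>slice_error\<close>), and integrating in time gives the convergence
(\<open>system_converges\<close>).\<close>

section \<open>Parabolic maximum principles\<close>

text \<open>Only times at which \<open>w\<close> is positive and \<open>z\<close> is a maximum point of \<open>w(-, t)\<close> over the compact set
matter, and nothing is asked there beyond the sign of the time derivative.  So every differential
inequality used below can be checked at points where the spatial gradient vanishes, and the space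
may be an interval or, after doubling the variable, a triangle.\<close>

lemma parabolic_maximum_principle:
  fixes w :: "'a::topological_space \<Rightarrow> real \<Rightarrow> real"
  assumes K: "compact K"
    and cont: "continuous_on (K \<times> {a..T}) (\<lambda>(z, t). w z t)"
    and init: "\<And>z. z \<in> K \<Longrightarrow> w z a \<le> 0"
    and step: "\<And>z t. \<lbrakk>z \<in> K; a < t; t \<le> T; w z t > 0; \<forall>y\<in>K. w y t \<le> w z t\<rbrakk>
                 \<Longrightarrow> \<exists>d\<le>0. ((\<lambda>s. w z s) has_real_derivative d) (at t)"
    and z: "z \<in> K" and t: "t \<in> {a..T}"
  shows "w z t \<le> 0"
proof (rule ccontr)
  assume "\<not> w z t \<le> 0"
  then have pos: "w z t > 0" by simp
  \<comment> \<open>Subtracting \<open>\<eta> (t - a)\<close> makes the sign of the time derivative strict at a maximum; the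
    \<open>+ 1\<close> keeps the divisor positive when \<open>T = a\<close>, and the factor \<open>1/2\<close> leaves a positive maximum.\<close>
  define c where "c = T - a + 1"
  define \<eta> where "\<eta> = w z t / 2 / c"
  define G where "G = (\<lambda>p. w (fst p) (snd p) - \<eta> * (snd p - a))"
  have c: "c > 0" using t by (auto simp: c_def)
  have \<eta>: "\<eta> > 0" using pos c by (simp add: \<eta>_def)
  have "\<eta> * (t - a) \<le> \<eta> * c" using \<eta> t by (intro mult_left_mono) (auto simp: c_def)
  also have "\<dots> = w z t / 2" using c by (simp add: \<eta>_def)
  finally have Gpos: "G (z, t) > 0" using pos by (simp add: G_def)
  have "continuous_on (K \<times> {a..T}) G"
    using cont unfolding G_def case_prod_unfold by (intro continuous_intros)
  moreover have "compact (K \<times> {a..T})" using K by (intro compact_Times) auto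
  ultimately obtain p where p: "p \<in> K \<times> {a..T}" and max: "\<forall>q\<in>K \<times> {a..T}. G q \<le> G p"
    using continuous_attains_sup[of "K \<times> {a..T}" G] z t by blast
  obtain y s where ys: "p = (y, s)" by force
  have yK: "y \<in> K" and s: "a \<le> s" "s \<le> T" using p ys by auto
  have Gp: "G (y, s) > 0" using Gpos max[rule_format, of "(z, t)"] z t ys by auto
  have wpos: "w y s > 0"
  proof -
    have "0 \<le> \<eta> * (s - a)" using s \<eta> by (intro mult_nonneg_nonneg) auto
    then show ?thesis using Gp by (simp add: G_def)
  qed
  have s0: "a < s" using wpos init[OF yK] s by (cases "s = a") auto
  have "w x s \<le> w y s" if "x \<in> K" for x
  proof -
    have "G (x, s) \<le> G (y, s)" using max that s ys by auto
    then show ?thesis by (simp add: G_def)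
  qed
  then obtain d where d: "d \<le> 0" "((\<lambda>s. w y s) has_real_derivative d) (at s)"
    using step[OF yK s0 s(2) wpos] by blast
  have "((\<lambda>r. G (y, r)) has_real_derivative d - \<eta>) (at s)"
    unfolding G_def by (auto intro!: derivative_eq_intros d(2))
  then obtain e where e: "e > 0" "\<And>r. 0 < r \<Longrightarrow> r < e \<Longrightarrow> G (y, s) < G (y, s - r)"
    using DERIV_neg_dec_left[of "\<lambda>r. G (y, r)" "d - \<eta>" s] d(1) \<eta> by force
  define r where "r = min (e / 2) (s - a)"
  have r: "0 < r" "r < e" "r \<le> s - a" using e(1) s0 by (auto simp: r_def)
  then have "(y, s - r) \<in> K \<times> {a..T}" using yK s by auto
  then have "G (y, s - r) \<le> G (y, s)" using max ys by blast
  then show False using e(2)[OF r(1,2)] by simp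
qed

lemma second_derivative_test:
  fixes \<phi> \<phi>' :: "real \<Rightarrow> real"
  assumes d: "d > 0" and max: "\<And>y. \<bar>y - x\<bar> < d \<Longrightarrow> \<phi> y \<le> \<phi> x"
    and D1: "\<And>y. \<bar>y - x\<bar> < d \<Longrightarrow> (\<phi> has_real_derivative \<phi>' y) (at y)"
    and D2: "(\<phi>' has_real_derivative c) (at x)"
  shows "\<phi>' x = 0" "c \<le> 0"
proof -
  show z: "\<phi>' x = 0"
    using DERIV_local_max[OF D1[of x] d] max d by (auto simp: abs_minus_commute)
  show "c \<le> 0"
  proof (rule ccontr)
    assume "\<not> c \<le> 0"
    then obtain e where e: "e > 0" "\<And>r. 0 < r \<Longrightarrow> r < e \<Longrightarrow> 0 < \<phi>' (x + r)"
      using DERIV_pos_inc_right[OF D2] z by force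
    define r where "r = min d e / 2"
    have r: "0 < r" "r < d" "r < e" using d e by (auto simp: r_def)
    have "\<phi> x < \<phi> (x + r)"
    proof (rule DERIV_pos_imp_increasing_open[of x "x + r" \<phi>])
      fix y assume y: "x < y" "y < x + r"
      then have "0 < \<phi>' y" using e(2)[of "y - x"] r by auto
      moreover have "(\<phi> has_real_derivative \<phi>' y) (at y)" using D1 y r by auto
      ultimately show "\<exists>l. (\<phi> has_real_derivative l) (at y) \<and> 0 < l" by blast
    next
      show "continuous_on {x..x + r} \<phi>"
        by (intro continuous_at_imp_continuous_on ballI DERIV_isCont[OF D1]) (use r in auto)
    qed (use r in auto)
    then show False using max[of "x + r"] r by auto
  qed
qed

text \<open>A boundary point cannot carry a positive maximum if \<open>w\<close> is nonpositive there (the last premise is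
then void, as for a Dirichlet condition) or if the outward derivative \<open>x * d\<close> is negative.\<close>

lemma max_principle_interval:
  fixes w w\<^sub>x w\<^sub>x\<^sub>x b :: "real \<Rightarrow> real \<Rightarrow> real"
  assumes cont: "continuous_on ({-1..1} \<times> {a..T}) (\<lambda>(x, t). w x t)"
    and init: "\<And>x. x \<in> {-1..1} \<Longrightarrow> w x a \<le> 0"
    and D1: "\<And>x t. \<lbrakk>x \<in> Omega; a < t; t \<le> T\<rbrakk> \<Longrightarrow> ((\<lambda>y. w y t) has_real_derivative w\<^sub>x x t) (at x)"
    and D2: "\<And>x t. \<lbrakk>x \<in> Omega; a < t; t \<le> T\<rbrakk> \<Longrightarrow> ((\<lambda>y. w\<^sub>x y t) has_real_derivative w\<^sub>x\<^sub>x x t) (at x)"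
    and Dt: "\<And>x t. \<lbrakk>x \<in> Omega; a < t; t \<le> T; w x t > 0\<rbrakk>
      \<Longrightarrow> \<exists>d \<le> w\<^sub>x\<^sub>x x t + b x t * w\<^sub>x x t. ((\<lambda>s. w x s) has_real_derivative d) (at t)"
    and bdry: "\<And>x t. \<lbrakk>x \<in> {-1, 1}; a < t; t \<le> T; w x t > 0\<rbrakk>
      \<Longrightarrow> \<exists>d. x * d < 0 \<and> ((\<lambda>y. w y t) has_real_derivative d) (at x within {-1..1})"
    and xt: "x \<in> {-1..1}" "t \<in> {a..T}"
  shows "w x t \<le> 0"
proof (rule parabolic_maximum_principle[OF compact_Icc cont init _ xt])
  fix x t assume x: "x \<in> {-1..1::real}" and t: "a < t" "t \<le> T" and pos: "w x t > 0"
    and max: "\<forall>y\<in>{-1..1}. w y t \<le> w x t"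
  consider "x = 1" | "x = -1" | "x \<in> Omega" using x by force
  then show "\<exists>d\<le>0. ((\<lambda>s. w x s) has_real_derivative d) (at t)"
  proof cases
    case 1
    obtain d where d: "d < 0" "((\<lambda>y. w y t) has_real_derivative d) (at 1 within {-1..1})"
      using bdry[of 1 t] t pos 1 by auto
    obtain e where e: "e > 0" "\<And>r. 0 < r \<Longrightarrow> 1 - r \<in> {-1..1} \<Longrightarrow> r < e \<Longrightarrow> w 1 t < w (1 - r) t"
      using has_real_derivative_neg_dec_left[OF d(2,1)] by blast
    define r where "r = min (e / 2) 1"
    have "w 1 t < w (1 - r) t" using e by (auto simp: r_def)
    moreover have "1 - r \<in> {-1..1}" using e(1) by (auto simp: r_def)
    ultimately show ?thesis using max[rule_format, of "1 - r"] 1 by simp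
  next
    case 2
    obtain d where d: "d > 0" "((\<lambda>y. w y t) has_real_derivative d) (at (-1) within {-1..1})"
      using bdry[of "-1" t] t pos 2 by auto
    obtain e where e: "e > 0" "\<And>r. 0 < r \<Longrightarrow> -1 + r \<in> {-1..1} \<Longrightarrow> r < e \<Longrightarrow> w (-1) t < w (-1 + r) t"
      using has_real_derivative_pos_inc_right[OF d(2,1)] by blast
    define r where "r = min (e / 2) 1"
    have "w (-1) t < w (-1 + r) t" using e by (auto simp: r_def)
    moreover have "-1 + r \<in> {-1..1}" using e(1) by (auto simp: r_def)
    ultimately show ?thesis using max[rule_format, of "-1 + r"] 2 by simp
  next
    case 3
    have eq: "w\<^sub>x x t = 0" "w\<^sub>x\<^sub>x x t \<le> 0"
    proof -
      have d: "min (1 - x) (x + 1) > 0" using 3 by auto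
      note test = second_derivative_test[OF d, of x "\<lambda>y. w y t" "\<lambda>y. w\<^sub>x y t" "w\<^sub>x\<^sub>x x t"]
      have near: "y \<in> Omega" if "\<bar>y - x\<bar> < min (1 - x) (x + 1)" for y
        using that by (auto simp: abs_if split: if_splits)
      show "w\<^sub>x x t = 0"
        by (rule test(1)) (use near max D1[OF _ t] D2[OF 3 t] in fastforce)+
      show "w\<^sub>x\<^sub>x x t \<le> 0"
        by (rule test(2)) (use near max D1[OF _ t] D2[OF 3 t] in fastforce)+
    qed
    obtain d where "d \<le> w\<^sub>x\<^sub>x x t + b x t * w\<^sub>x x t" "((\<lambda>s. w x s) has_real_derivative d) (at t)"
      using Dt[OF 3 t pos] by blast
    then show ?thesis using eq by (intro exI[of _ d]) auto
  qed
qed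

text \<open>Differentiating the equation in \<open>x\<close> would require bounds on the derivative of the drift
coefficient, which may blow up as \<open>t\<close> tends to \<open>0\<close>.  Instead
\<open>\<Phi>(x, t) - \<Phi>(y, t)\<close> is treated as a function on the triangle \<open>x \<le> y\<close>: it solves a
parabolic equation in two space variables, vanishes on the diagonal, and is nonpositive on the
other two sides because \<open>\<Phi>\<close> stays between its two constant boundary values.\<close>

lemma heat_drift_preserves_monotone:
  fixes \<Phi> \<Phi>\<^sub>x \<Phi>\<^sub>x\<^sub>x b :: "real \<Rightarrow> real \<Rightarrow> real"
  assumes cont: "continuous_on ({-1..1} \<times> {0..}) (\<lambda>(x, t). \<Phi> x t)"
    and D1: "\<And>x t. \<lbrakk>x \<in> Omega; 0 < t\<rbrakk> \<Longrightarrow> ((\<lambda>y. \<Phi> y t) has_real_derivative \<Phi>\<^sub>x x t) (at x)"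
    and D2: "\<And>x t. \<lbrakk>x \<in> Omega; 0 < t\<rbrakk> \<Longrightarrow> ((\<lambda>y. \<Phi>\<^sub>x y t) has_real_derivative \<Phi>\<^sub>x\<^sub>x x t) (at x)"
    and Dt: "\<And>x t. \<lbrakk>x \<in> Omega; 0 < t\<rbrakk>
      \<Longrightarrow> ((\<lambda>s. \<Phi> x s) has_real_derivative \<Phi>\<^sub>x\<^sub>x x t + b x t * \<Phi>\<^sub>x x t) (at t)"
    and left: "\<And>t. 0 \<le> t \<Longrightarrow> \<Phi> (-1) t = l" and right: "\<And>t. 0 \<le> t \<Longrightarrow> \<Phi> 1 t = r"
    and init: "mono_on {-1..1} (\<lambda>x. \<Phi> x 0)"
    and t: "0 \<le> t"
  shows "mono_on {-1..1} (\<lambda>x. \<Phi> x t)"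
proof -
  have cont': "continuous_on ({-1..1} \<times> {0..t}) (\<lambda>(x, t). \<Phi> x t)"
    by (rule continuous_on_subset[OF cont]) auto
  have init_le: "\<Phi> x 0 \<le> \<Phi> y 0" if "-1 \<le> x" "x \<le> y" "y \<le> 1" for x y
    using monotone_onD[OF init, of x y] that by auto
  have upper: "\<Phi> x s - r \<le> 0" if "x \<in> {-1..1}" "s \<in> {0..t}" for x s
  proof (rule max_principle_interval[where w = "\<lambda>x s. \<Phi> x s - r" and a = 0 and T = t and w\<^sub>x = \<Phi>\<^sub>x
        and w\<^sub>x\<^sub>x = \<Phi>\<^sub>x\<^sub>x and b = b])
    show "continuous_on ({-1..1} \<times> {0..t}) (\<lambda>(x, s). \<Phi> x s - r)"
      using cont' unfolding case_prod_unfold by (intro continuous_intros)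
    show "\<Phi> x 0 - r \<le> 0" if "x \<in> {-1..1}" for x using init_le[of x 1] right[of 0] that by simp
  next
    fix x s assume "x \<in> {-1, 1::real}" "0 < s" "0 < \<Phi> x s - r"
    then show "\<exists>d. x * d < 0 \<and> ((\<lambda>y. \<Phi> y s - r) has_real_derivative d) (at x within {-1..1})"
      using left[of s] right[of s] init_le[of "-1" 1] left[of 0] right[of 0] by auto
  qed (use that D1 D2 Dt in \<open>auto intro!: derivative_eq_intros exI[of _ "\<Phi>\<^sub>x\<^sub>x _ _ + _"]\<close>)
  have lower: "l - \<Phi> x s \<le> 0" if "x \<in> {-1..1}" "s \<in> {0..t}" for x s
  proof (rule max_principle_interval[where w = "\<lambda>x s. l - \<Phi> x s" and a = 0 and T = t
        and w\<^sub>x = "\<lambda>x s. - \<Phi>\<^sub>x x s" and w\<^sub>x\<^sub>x = "\<lambda>x s. - \<Phi>\<^sub>x\<^sub>x x s" and b = b])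
    show "continuous_on ({-1..1} \<times> {0..t}) (\<lambda>(x, s). l - \<Phi> x s)"
      using cont' unfolding case_prod_unfold by (intro continuous_intros)
    show "l - \<Phi> x 0 \<le> 0" if "x \<in> {-1..1}" for x using init_le[of "-1" x] left[of 0] that by simp
    fix x s assume "x \<in> {-1, 1::real}" "0 < s" "0 < l - \<Phi> x s"
    then show "\<exists>d. x * d < 0 \<and> ((\<lambda>y. l - \<Phi> y s) has_real_derivative d) (at x within {-1..1})"
      using left[of s] right[of s] init_le[of "-1" 1] left[of 0] right[of 0] by auto
  next
    fix x s :: real assume "x \<in> Omega" "0 < s"
    then have "((\<lambda>s. l - \<Phi> x s) has_real_derivative 0 - (\<Phi>\<^sub>x\<^sub>x x s + b x s * \<Phi>\<^sub>x x s)) (at s)"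
      by (intro derivative_intros Dt)
    then show "\<exists>d\<le>- \<Phi>\<^sub>x\<^sub>x x s + b x s * - \<Phi>\<^sub>x x s. ((\<lambda>s. l - \<Phi> x s) has_real_derivative d) (at s)"
      by (intro exI[of _ "- (\<Phi>\<^sub>x\<^sub>x x s + b x s * \<Phi>\<^sub>x x s)"]) auto
  qed (use that D1 D2 in \<open>auto intro!: derivative_eq_intros\<close>)
  define K where "K = {-1..1::real} \<times> {-1..1::real} \<inter> {p. fst p \<le> snd p}"
  have "compact K" unfolding K_def
    by (intro compact_Int_closed compact_Times closed_Collect_le continuous_intros compact_Icc)
  have main: "\<Phi> (fst p) t - \<Phi> (snd p) t \<le> 0" if p: "p \<in> K" for p
  proof (rule parabolic_maximum_principle[OF \<open>compact K\<close>, where a = 0 and T = t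
        and w = "\<lambda>p s. \<Phi> (fst p) s - \<Phi> (snd p) s"])
    show "continuous_on (K \<times> {0..t}) (\<lambda>(p, s). \<Phi> (fst p) s - \<Phi> (snd p) s)"
    proof -
      have "continuous_on (K \<times> {0..t}) (\<lambda>q. (\<lambda>(x, t). \<Phi> x t) (fst (fst q), snd q))"
        by (rule continuous_on_compose2[OF cont']) (auto intro!: continuous_intros simp: K_def)
      moreover have "continuous_on (K \<times> {0..t}) (\<lambda>q. (\<lambda>(x, t). \<Phi> x t) (snd (fst q), snd q))"
        by (rule continuous_on_compose2[OF cont']) (auto intro!: continuous_intros simp: K_def)
      ultimately show ?thesis unfolding case_prod_unfold by (auto intro!: continuous_intros)
    qed
    show "\<Phi> (fst p) 0 - \<Phi> (snd p) 0 \<le> 0" if "p \<in> K" for p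
      using init_le[of "fst p" "snd p"] that by (auto simp: K_def)
  next
    fix p s assume p: "p \<in> K" and s: "0 < s" "s \<le> t" and pos: "0 < \<Phi> (fst p) s - \<Phi> (snd p) s"
      and max: "\<forall>q\<in>K. \<Phi> (fst q) s - \<Phi> (snd q) s \<le> \<Phi> (fst p) s - \<Phi> (snd p) s"
    obtain x y where xy: "p = (x, y)" by force
    have le: "-1 \<le> x" "x \<le> y" "y \<le> 1" using p by (auto simp: K_def xy)
    \<comment> \<open>A positive maximum lies in the open triangle, where both one-variable tests apply.\<close>
    have "x \<noteq> -1" using pos left[of s] lower[of y s] s le by (auto simp: xy)
    moreover have "y \<noteq> 1" using pos right[of s] upper[of x s] s le by (auto simp: xy)
    moreover have "x \<noteq> y" using pos by (auto simp: xy)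
    ultimately have lt: "-1 < x" "x < y" "y < 1" using le by auto
    have maxx: "\<Phi> z s \<le> \<Phi> x s" if "-1 \<le> z" "z \<le> y" for z
      using max[rule_format, of "(z, y)"] that le by (auto simp: K_def xy)
    have miny: "- \<Phi> z s \<le> - \<Phi> y s" if "x \<le> z" "z \<le> 1" for z
      using max[rule_format, of "(x, z)"] that le by (auto simp: K_def xy)
    have dx: "min (x + 1) (y - x) > 0" and dy: "min (y - x) (1 - y) > 0" using lt by auto
    have x: "\<Phi>\<^sub>x x s = 0" "\<Phi>\<^sub>x\<^sub>x x s \<le> 0"
      using second_derivative_test[OF dx, of x "\<lambda>z. \<Phi> z s" "\<lambda>z. \<Phi>\<^sub>x z s" "\<Phi>\<^sub>x\<^sub>x x s"]
        maxx D1 D2 lt s by (auto simp: abs_if split: if_splits)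
    have y: "\<Phi>\<^sub>x y s = 0" "\<Phi>\<^sub>x\<^sub>x y s \<ge> 0"
    proof -
      have D1': "((\<lambda>z. - \<Phi> z s) has_real_derivative - \<Phi>\<^sub>x z s) (at z)"
        if "\<bar>z - y\<bar> < min (y - x) (1 - y)" for z
        using that lt s by (intro derivative_intros D1) (auto simp: abs_if split: if_splits)
      have D2': "((\<lambda>z. - \<Phi>\<^sub>x z s) has_real_derivative - \<Phi>\<^sub>x\<^sub>x y s) (at y)"
        using lt s by (intro derivative_intros D2) auto
      have "- \<Phi>\<^sub>x y s = 0" "- \<Phi>\<^sub>x\<^sub>x y s \<le> 0"
        using second_derivative_test[OF dy _ D1' D2'] miny lt by (auto simp: abs_if split: if_splits)
      then show "\<Phi>\<^sub>x y s = 0" "\<Phi>\<^sub>x\<^sub>x y s \<ge> 0" by auto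
    qed
    have "((\<lambda>s. \<Phi> x s - \<Phi> y s) has_real_derivative
        (\<Phi>\<^sub>x\<^sub>x x s + b x s * \<Phi>\<^sub>x x s) - (\<Phi>\<^sub>x\<^sub>x y s + b y s * \<Phi>\<^sub>x y s)) (at s)"
      using lt s by (intro derivative_intros Dt) auto
    then show "\<exists>d\<le>0. ((\<lambda>s. \<Phi> (fst p) s - \<Phi> (snd p) s) has_real_derivative d) (at s)"
      using x y by (intro exI[of _ "\<Phi>\<^sub>x\<^sub>x x s - \<Phi>\<^sub>x\<^sub>x y s"]) (auto simp: xy)
  qed (use p t in auto)
  show ?thesis
  proof (rule monotone_onI)
    fix x y :: real assume "x \<in> {-1..1}" "y \<in> {-1..1}" "x \<le> y"
    then show "\<Phi> x t \<le> \<Phi> y t" using main[of "(x, y)"] by (auto simp: K_def)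
  qed
qed

section \<open>Conservation laws and cumulative mass\<close>

definition primitive :: "(real \<Rightarrow> real \<Rightarrow> real) \<Rightarrow> real \<Rightarrow> real \<Rightarrow> real" where
  "primitive w x t = integral {-1..x} (\<lambda>y. w y t)"

lemma primitive_left [simp]: "primitive w (-1) t = 0"
  by (simp add: primitive_def)

lemma continuous_on_slice:
  assumes "continuous_on (A \<times> B) (\<lambda>(x, t). w x t)" "t \<in> B"
  shows "continuous_on A (\<lambda>x. w x t)"
proof -
  have "continuous_on A (\<lambda>x. (\<lambda>(x, t). w x t) (x, t))"
    by (rule continuous_on_compose2[OF assms(1)]) (use assms(2) in \<open>auto intro!: continuous_intros\<close>)
  then show ?thesis by simp
qed

lemma continuous_on_slice_time:
  assumes "continuous_on (A \<times> B) (\<lambda>(x, t). w x t)" "x \<in> A"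
  shows "continuous_on B (\<lambda>t. w x t)"
proof -
  have "continuous_on B (\<lambda>t. (\<lambda>(x, t). w x t) (x, t))"
    by (rule continuous_on_compose2[OF assms(1)]) (use assms(2) in \<open>auto intro!: continuous_intros\<close>)
  then show ?thesis by simp
qed

text \<open>Rescaling to a fixed interval of integration turns joint continuity of the primitive into
continuity of a parameter integral.\<close>

lemma primitive_affine:
  assumes "continuous_on {-1..1} (\<lambda>x. w x t)" "x \<in> {-1..1}"
  shows "primitive w x t = (x + 1) * integral {0..1} (\<lambda>s. w (-1 + s * (x + 1)) t)"
proof (cases "x = -1")
  case False
  then have x: "x + 1 > 0" using assms by auto
  have "continuous_on {-1..x} (\<lambda>y. w y t)"
    by (rule continuous_on_subset[OF assms(1)]) (use assms(2) in auto)
  then have "((\<lambda>y. w y t) has_integral primitive w x t) (cbox (-1) x)"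
    unfolding primitive_def by (auto intro!: integrable_integral integrable_continuous_interval)
  from has_integral_affinity'[OF this x, of "-1"]
  have "((\<lambda>s. w (-1 + s * (x + 1)) t) has_integral primitive w x t / (x + 1)) {0..1}"
    using x by (simp add: divide_inverse mult.commute)
  then show ?thesis using x by (simp add: integral_unique)
qed simp

lemma continuous_on_primitive:
  assumes "continuous_on ({-1..1} \<times> S) (\<lambda>(x, t). w x t)"
  shows "continuous_on ({-1..1} \<times> S) (\<lambda>(x, t). primitive w x t)"
proof -
  have arg: "-1 + s * (x + 1) \<in> {-1..1}" if "s \<in> {0..1}" "x \<in> {-1..1}" for s x :: real
    using that mult_mono[of s 1 "x + 1" 2] by auto
  have "continuous_on (({-1..1} \<times> S) \<times> cbox 0 1)
      (\<lambda>p. (\<lambda>(x, t). w x t) (-1 + snd p * (fst (fst p) + 1), snd (fst p)))"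
    by (rule continuous_on_compose2[OF assms]) (use arg in \<open>auto intro!: continuous_intros\<close>)
  then have "continuous_on (({-1..1} \<times> S) \<times> cbox 0 1)
      (\<lambda>(q, s). w (-1 + s * (fst q + 1)) (snd q))"
    by (simp add: case_prod_unfold)
  then have "continuous_on ({-1..1} \<times> S)
      (\<lambda>q. (fst q + 1) * integral (cbox 0 1) (\<lambda>s. w (-1 + s * (fst q + 1)) (snd q)))"
    by (intro continuous_intros integral_continuous_on_param)
  then show ?thesis
  proof (rule continuous_on_eq)
    fix q :: "real \<times> real" assume "q \<in> {-1..1} \<times> S"
    then have "primitive w (fst q) (snd q) =
        (fst q + 1) * integral {0..1} (\<lambda>s. w (-1 + s * (fst q + 1)) (snd q))"
      by (intro primitive_affine continuous_on_slice[OF assms]) auto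
    then show "(fst q + 1) * integral (cbox 0 1) (\<lambda>s. w (-1 + s * (fst q + 1)) (snd q)) =
        (\<lambda>(x, t). primitive w x t) q"
      by (simp add: case_prod_unfold)
  qed
qed

lemma primitive_has_derivative_space:
  assumes "continuous_on {-1..1} (\<lambda>x. w x t)" "x \<in> {-1..1}"
  shows "((\<lambda>y. primitive w y t) has_real_derivative w x t) (at x within {-1..1})"
  unfolding primitive_def using integral_has_real_derivative[OF assms] .

text \<open>The conservation law \<open>w\<^sub>t = J\<^sub>x\<close> with \<open>J = 0\<close> at both ends, with continuity at \<open>t = 0\<close>
asked of \<open>w\<close> alone, since the derivatives of a classical solution may be unbounded there.\<close>

definition no_flux_law ::
  "(real \<Rightarrow> real \<Rightarrow> real) \<Rightarrow> (real \<Rightarrow> real \<Rightarrow> real) \<Rightarrow> (real \<Rightarrow> real \<Rightarrow> real) \<Rightarrow> bool" where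
  "no_flux_law w w\<^sub>t J \<longleftrightarrow>
     continuous_on ({-1..1} \<times> {0..}) (\<lambda>(x, t). w x t) \<and>
     continuous_on ({-1..1} \<times> {0<..}) (\<lambda>(x, t). w\<^sub>t x t) \<and>
     (\<forall>x\<in>{-1..1}. \<forall>t>0. ((\<lambda>s. w x s) has_real_derivative w\<^sub>t x t) (at t)) \<and>
     (\<forall>t>0. continuous_on {-1..1} (\<lambda>x. J x t)) \<and>
     (\<forall>x\<in>Omega. \<forall>t>0. ((\<lambda>y. J y t) has_real_derivative w\<^sub>t x t) (at x)) \<and>
     (\<forall>t>0. J (-1) t = 0 \<and> J 1 t = 0)"

text \<open>Integrating \<open>w\<^sub>t = J\<^sub>x\<close> from the end where the flux vanishes turns the conservation law
into \<open>\<Phi>\<^sub>t = J\<close> for the cumulative mass \<open>\<Phi>\<close>.\<close>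

lemma primitive_has_derivative_time:
  assumes law: "no_flux_law w w\<^sub>t J" and x: "x \<in> {-1..1}" and t: "t > 0"
  shows "((\<lambda>s. primitive w x s) has_real_derivative J x t) (at t)"
proof -
  have cont: "continuous_on ({-1..1} \<times> {0..}) (\<lambda>(x, t). w x t)"
    and contt: "continuous_on ({-1..1} \<times> {0<..}) (\<lambda>(x, t). w\<^sub>t x t)"
    and Dt: "\<And>x t. x \<in> {-1..1} \<Longrightarrow> t > 0 \<Longrightarrow> ((\<lambda>s. w x s) has_real_derivative w\<^sub>t x t) (at t)"
    and J: "continuous_on {-1..1} (\<lambda>x. J x t)"
    and DJ: "\<And>x. x \<in> Omega \<Longrightarrow> ((\<lambda>y. J y t) has_real_derivative w\<^sub>t x t) (at x)"
    and J0: "J (-1) t = 0"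
    using law t by (auto simp: no_flux_law_def)
  have "((\<lambda>s. integral (cbox (-1) x) (\<lambda>y. w y s)) has_field_derivative
      integral (cbox (-1) x) (\<lambda>y. w\<^sub>t y t)) (at t within {0<..})"
  proof (rule leibniz_rule_field_derivative)
    show "((\<lambda>s. w y s) has_real_derivative w\<^sub>t y s) (at s within {0<..})"
      if "s \<in> {0<..}" "y \<in> cbox (-1) x" for s y
      using Dt[of y s] that x by (auto intro: has_field_derivative_at_within)
    show "(\<lambda>y. w y s) integrable_on cbox (-1) x" if "s \<in> {0<..}" for s
      using continuous_on_subset[OF continuous_on_slice[OF cont, of s], of "{-1..x}"] that x
      by (auto intro!: integrable_continuous_interval)
    have "continuous_on ({0<..} \<times> cbox (-1) x) (\<lambda>p. (\<lambda>(x, t). w\<^sub>t x t) (snd p, fst p))"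
      by (rule continuous_on_compose2[OF contt]) (use x in \<open>auto intro!: continuous_intros\<close>)
    then show "continuous_on ({0<..} \<times> cbox (-1) x) (\<lambda>(s, y). w\<^sub>t y s)"
      by (simp add: case_prod_unfold)
  qed (use t in auto)
  moreover have "integral {-1..x} (\<lambda>y. w\<^sub>t y t) = J x t"
  proof -
    have "((\<lambda>y. w\<^sub>t y t) has_integral (J x t - J (-1) t)) {-1..x}"
    proof (rule fundamental_theorem_of_calculus_interior)
      show "continuous_on {-1..x} (\<lambda>y. J y t)" by (rule continuous_on_subset[OF J]) (use x in auto)
      show "((\<lambda>y. J y t) has_vector_derivative w\<^sub>t y t) (at y)" if "y \<in> {-1<..<x}" for y
        using DJ[of y] that x by (auto simp: has_real_derivative_iff_has_vector_derivative)
    qed (use x in auto)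
    then show ?thesis using J0 by (simp add: integral_unique)
  qed
  ultimately show ?thesis
    using t by (simp add: primitive_def at_within_open[of t "{0<..}"])
qed

lemma mass_conserved:
  assumes law: "no_flux_law w w\<^sub>t J" and t: "t \<ge> 0"
  shows "primitive w 1 t = primitive w 1 0"
proof (cases "t = 0")
  case False
  then have t: "t > 0" using t by simp
  have "continuous_on ({-1..1} \<times> {0..}) (\<lambda>(x, t). w x t)" using law by (simp add: no_flux_law_def)
  then have "continuous_on {0..} (\<lambda>s. primitive w 1 s)"
    by (intro continuous_on_slice_time[OF continuous_on_primitive]) auto
  then have cont: "continuous_on {0..t} (\<lambda>s. primitive w 1 s)"
    by (rule continuous_on_subset) auto
  have "((\<lambda>s. primitive w 1 s) has_real_derivative 0) (at s)" if "s > 0" for s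
    using primitive_has_derivative_time[OF law, of 1 s] law that by (auto simp: no_flux_law_def)
  then show ?thesis using DERIV_isconst_end[OF t cont] by auto
qed simp

lemma nonneg_closed_interval:
  assumes "continuous_on {-1..1} v" "\<And>x. x \<in> Omega \<Longrightarrow> 0 \<le> v x" "x \<in> {-1..1}"
  shows "0 \<le> (v x :: real)"
  using continuous_ge_on_closure[of Omega v x 0] assms by auto

lemma primitive_mono_iff:
  assumes cont: "continuous_on {-1..1} (\<lambda>x. w x t)"
  shows "mono_on {-1..1} (\<lambda>x. primitive w x t) \<longleftrightarrow> (\<forall>x\<in>{-1..1}. 0 \<le> w x t)"
proof
  assume mono: "mono_on {-1..1} (\<lambda>x. primitive w x t)"
  have "0 \<le> w x t" if "x \<in> Omega" for x
  proof (rule mono_on_imp_deriv_nonneg[OF mono])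
    show "((\<lambda>x. primitive w x t) has_real_derivative w x t) (at x)"
      using primitive_has_derivative_space[of w t x] cont that by (auto simp: at_within_Icc_at)
  qed (use that in simp)
  then show "\<forall>x\<in>{-1..1}. 0 \<le> w x t" using nonneg_closed_interval[OF cont] by auto
next
  assume nonneg: "\<forall>x\<in>{-1..1}. 0 \<le> w x t"
  show "mono_on {-1..1} (\<lambda>x. primitive w x t)"
    unfolding primitive_def
  proof (intro monotone_onI integral_subset_le)
    fix x y :: real assume "x \<in> {-1..1}" "y \<in> {-1..1}" "x \<le> y"
    then show "(\<lambda>x. w x t) integrable_on {-1..x}" "(\<lambda>x. w x t) integrable_on {-1..y}"
      by (auto intro!: integrable_continuous_interval continuous_on_subset[OF cont])
  qed (use nonneg in auto)
qed

lemma primitive_nonneg: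
  assumes "continuous_on {-1..1} (\<lambda>x. w x t)" "\<And>y. y \<in> {-1..1} \<Longrightarrow> 0 \<le> w y t" "x \<in> {-1..1}"
  shows "0 \<le> primitive w x t"
  unfolding primitive_def
proof (rule Henstock_Kurzweil_Integration.integral_nonneg)
  show "(\<lambda>y. w y t) integrable_on {-1..x}"
    by (intro integrable_continuous_interval continuous_on_subset[OF assms(1)]) (use assms(3) in auto)
qed (use assms in auto)

text \<open>The cumulative mass of \<open>w\<close> satisfies \<open>\<Phi>\<^sub>t = \<Phi>\<^sub>x\<^sub>x + b \<Phi>\<^sub>x\<close> with constant boundary values, so it
stays nondecreasing; its slope is \<open>w\<close>.  Passing to the primitive replaces the Robin condition of
\<open>w\<close> by a Dirichlet condition.\<close>

lemma drift_diffusion_nonneg: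
  assumes law: "no_flux_law w w\<^sub>t J"
    and Dx: "\<And>x t. x \<in> Omega \<Longrightarrow> t > 0 \<Longrightarrow> ((\<lambda>y. w y t) has_real_derivative w\<^sub>x x t) (at x)"
    and J: "\<And>x t. x \<in> Omega \<Longrightarrow> t > 0 \<Longrightarrow> J x t = w\<^sub>x x t + b x t * w x t"
    and init: "\<And>x. x \<in> Omega \<Longrightarrow> 0 \<le> w x 0"
    and xt: "x \<in> {-1..1}" "t \<ge> 0"
  shows "0 \<le> w x t"
proof -
  have cont: "continuous_on ({-1..1} \<times> {0..}) (\<lambda>(x, t). w x t)"
    using law by (simp add: no_flux_law_def)
  have slice: "continuous_on {-1..1} (\<lambda>x. w x t)" if "t \<ge> 0" for t
    using continuous_on_slice[OF cont] that by auto
  have "mono_on {-1..1} (\<lambda>x. primitive w x t)"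
  proof (rule heat_drift_preserves_monotone[where \<Phi> = "primitive w" and \<Phi>\<^sub>x = w and \<Phi>\<^sub>x\<^sub>x = w\<^sub>x and b = b])
    show "((\<lambda>y. primitive w y t) has_real_derivative w x t) (at x)" if "x \<in> Omega" "0 < t" for x t
      using primitive_has_derivative_space[of w t x, OF slice[of t]] that by (auto simp: at_within_Icc_at)
    show "((\<lambda>s. primitive w x s) has_real_derivative w\<^sub>x x t + b x t * w x t) (at t)"
      if "x \<in> Omega" "0 < t" for x t
    proof -
      have "x \<in> {-1..1}" using that by auto
      then show ?thesis using primitive_has_derivative_time[OF law _ that(2)] J[OF that] by metis
    qed
    show "mono_on {-1..1} (\<lambda>x. primitive w x 0)"
      unfolding primitive_mono_iff[of w 0, OF slice[OF order_refl]]
      using nonneg_closed_interval[OF slice[OF order_refl] init] by blast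
    show "primitive w 1 t = primitive w 1 0" if "0 \<le> t" for t by (rule mass_conserved[OF law that])
    show "continuous_on ({-1..1} \<times> {0..}) (\<lambda>(x, t). primitive w x t)"
      by (rule continuous_on_primitive[OF cont])
  qed (use xt Dx in simp_all)
  then show ?thesis using primitive_mono_iff[of w t, OF slice[OF xt(2)]] xt(1) by blast
qed

lemma primitive_initial_mass:
  assumes "\<And>x. x \<in> Omega \<Longrightarrow> w x 0 = w0 x"
  shows "primitive w 1 0 = integral Omega w0"
proof -
  have "primitive w 1 0 = integral Omega (\<lambda>x. w x 0)"
    unfolding primitive_def by (rule integral_open_interval_real)
  also have "\<dots> = integral Omega w0" by (intro integral_cong assms)
  finally show ?thesis .
qed

lemma no_flux_law_lincomb:
  assumes "no_flux_law w w\<^sub>t J" "no_flux_law v v\<^sub>t L"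
  shows "no_flux_law (\<lambda>x t. a * w x t + c * v x t) (\<lambda>x t. a * w\<^sub>t x t + c * v\<^sub>t x t)
    (\<lambda>x t. a * J x t + c * L x t)"
proof -
  have "((\<lambda>z. a * \<phi> z + c * \<psi> z) has_real_derivative a * D + c * E) (at x)"
    if "(\<phi> has_real_derivative D) (at x)" "(\<psi> has_real_derivative E) (at x)" for \<phi> \<psi> D E and x :: real
    using that by (auto intro!: derivative_eq_intros)
  then show ?thesis
    using assms unfolding no_flux_law_def case_prod_unfold
    by (auto intro!: continuous_on_add continuous_on_mult_left)
qed

section \<open>The heat equation with Neumann conditions\<close>

lemma classical_derivatives:
  assumes "classical_with_datum w0 w" and t: "t > 0"
  shows "x \<in> {-1..1} \<Longrightarrow> ((\<lambda>y. w y t) has_real_derivative pd_x w x t) (at x within {-1..1})"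
    and "x \<in> Omega \<Longrightarrow> ((\<lambda>y. pd_x w y t) has_real_derivative pd_x (pd_x w) x t) (at x)"
    and "x \<in> {-1..1} \<Longrightarrow> ((\<lambda>s. w x s) has_real_derivative pd_t w x t) (at t)"
    and "continuous_on {-1..1} (\<lambda>x. pd_x w x t)"
proof -
  have "Ck_up_to_boundary (Suc (Suc 0)) w" using assms unfolding classical_with_datum_def by blast
  then have D: "\<forall>x\<in>{-1..1}. \<forall>t>0. (\<lambda>y. w y t) differentiable (at x within {-1..1}) \<and>
        (\<lambda>s. w x s) differentiable (at t)"
    and Dx: "\<forall>x\<in>{-1..1}. \<forall>t>0. (\<lambda>y. pd_x w y t) differentiable (at x within {-1..1}) \<and>
        (\<lambda>s. pd_x w x s) differentiable (at t)"
    and cont: "continuous_on ({-1..1} \<times> {0<..}) (\<lambda>(x, t). pd_x w x t)"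
    unfolding Ck_up_to_boundary.simps by blast+
  have diff: "((\<lambda>y. v y t) has_real_derivative pd_x v x t) (at x within {-1..1})"
    if "(\<lambda>y. v y t) differentiable (at x within {-1..1})" for v x
    using that by (simp add: pd_x_def vector_derivative_works has_real_derivative_iff_has_vector_derivative)
  show "((\<lambda>y. w y t) has_real_derivative pd_x w x t) (at x within {-1..1})" if "x \<in> {-1..1}"
    using D that t by (intro diff) blast
  show "((\<lambda>y. pd_x w y t) has_real_derivative pd_x (pd_x w) x t) (at x)" if "x \<in> Omega"
  proof -
    have "x \<in> {-1..1}" using that by auto
    then have "((\<lambda>y. pd_x w y t) has_real_derivative pd_x (pd_x w) x t) (at x within {-1..1})"
      using Dx t by (intro diff) blast
    then show ?thesis using that by (simp add: at_within_Icc_at)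
  qed
  show "((\<lambda>s. w x s) has_real_derivative pd_t w x t) (at t)" if "x \<in> {-1..1}"
  proof -
    have "(\<lambda>s. w x s) differentiable (at t)" using D that t by blast
    then show ?thesis
      by (simp add: pd_t_def vector_derivative_works has_real_derivative_iff_has_vector_derivative)
  qed
  show "continuous_on {-1..1} (\<lambda>x. pd_x w x t)"
    by (rule continuous_on_slice[OF cont]) (use t in simp)
qed

lemma classical_continuous:
  assumes "classical_with_datum w0 w"
  shows "continuous_on ({-1..1} \<times> {0..}) (\<lambda>(x, t). w x t)"
    and "continuous_on ({-1..1} \<times> {0<..}) (\<lambda>(x, t). pd_t w x t)"
proof -
  have "Ck_up_to_boundary (Suc 0) w" using assms unfolding classical_with_datum_def by blast
  then show "continuous_on ({-1..1} \<times> {0<..}) (\<lambda>(x, t). pd_t w x t)"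
    unfolding Ck_up_to_boundary.simps by blast
  show "continuous_on ({-1..1} \<times> {0..}) (\<lambda>(x, t). w x t)"
    using assms unfolding classical_with_datum_def by blast
qed

lemma heat_no_flux_law:
  assumes "heat_neumann_solution h0 h"
  shows "no_flux_law h (pd_t h) (pd_x h)"
proof -
  have cl: "classical_with_datum h0 h" using assms by (simp add: heat_neumann_solution_def)
  have "((\<lambda>y. pd_x h y t) has_real_derivative pd_t h x t) (at x)" if "x \<in> Omega" "t > 0" for x t
    using classical_derivatives(2)[OF cl that(2,1)] assms that by (auto simp: heat_neumann_solution_def)
  then show ?thesis
    using classical_continuous[OF cl] classical_derivatives(3,4)[OF cl] assms
    by (auto simp: no_flux_law_def heat_neumann_solution_def)
qed

text \<open>The difference of two solutions has zero initial datum, in particular a nonnegative one.\<close>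

lemma heat_unique_le:
  assumes h: "heat_neumann_solution h0 h" and k: "heat_neumann_solution h0 k"
    and xt: "x \<in> {-1..1}" "t \<ge> 0"
  shows "h x t \<le> k x t"
proof -
  have cl: "classical_with_datum h0 h" "classical_with_datum h0 k"
    using h k by (auto simp: heat_neumann_solution_def)
  have "0 \<le> 1 * k x t + (-1) * h x t"
  proof (rule drift_diffusion_nonneg[OF no_flux_law_lincomb[OF heat_no_flux_law[OF k] heat_no_flux_law[OF h]],
        where w\<^sub>x = "\<lambda>x t. 1 * pd_x k x t + (-1) * pd_x h x t" and b = "\<lambda>x t. 0"])
    fix x t assume "x \<in> Omega" "t > (0::real)"
    then show "((\<lambda>y. 1 * k y t + -1 * h y t) has_real_derivative
        1 * pd_x k x t + -1 * pd_x h x t) (at x)"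
      using classical_derivatives(1)[OF cl(1), of t x] classical_derivatives(1)[OF cl(2), of t x]
      by (auto simp: at_within_Icc_at intro!: derivative_eq_intros)
  qed (use xt cl in \<open>auto simp: classical_with_datum_def\<close>)
  then show ?thesis by simp
qed

lemma heat_unique:
  assumes "heat_neumann_solution h0 h" "heat_neumann_solution h0 k" "x \<in> {-1..1}" "t \<ge> 0"
  shows "h x t = k x t"
  using heat_unique_le[of h0 h k x t] heat_unique_le[of h0 k h x t] assms by auto

locale neumann_heat =
  fixes h0 :: "real \<Rightarrow> real" and h :: "real \<Rightarrow> real \<Rightarrow> real"
  assumes heat: "heat_neumann_solution h0 h" and h0_nonneg: "\<And>x. x \<in> Omega \<Longrightarrow> 0 \<le> h0 x"
begin

lemma classical_h: "classical_with_datum h0 h"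
  using heat by (simp add: heat_neumann_solution_def)

lemmas h_derivatives = classical_derivatives[OF classical_h]
lemmas h_law = heat_no_flux_law[OF heat]
lemmas continuous_h = classical_continuous(1)[OF classical_h]

lemma continuous_h_slice: "t \<ge> 0 \<Longrightarrow> continuous_on {-1..1} (\<lambda>x. h x t)"
  using continuous_on_slice[OF continuous_h] by auto

lemma h_nonneg: "0 \<le> h x t" if "x \<in> {-1..1}" "t \<ge> 0"
proof (rule drift_diffusion_nonneg[OF h_law, where w\<^sub>x = "pd_x h" and b = "\<lambda>x t. 0"])
  show "((\<lambda>y. h y t) has_real_derivative pd_x h x t) (at x)" if "x \<in> Omega" "t > 0" for x t
    using h_derivatives(1)[of t x] that by (auto simp: at_within_Icc_at)
qed (use that h0_nonneg classical_h in \<open>auto simp: classical_with_datum_def\<close>)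

text \<open>A quantitative strong maximum principle.  The barrier is \<open>\<kappa> e\<^bsup>-K s\<^esup> q\<^sup>3\<close> with
\<open>q(y, s) = r\<^sup>2 + \<beta> s - (y - x0)\<^sup>2\<close>: initially it is positive only within distance \<open>r\<close> of \<open>x0\<close>, where it
is below \<open>h\<close>; its region of positivity then expands and covers the whole interval at
time \<open>t\<close>.  Where \<open>q > 0\<close> it is a subsolution with negative outward derivative at the boundary, and
where \<open>q \<le> 0\<close> it cannot exceed \<open>h \<ge> 0\<close>; the odd power is what makes it negative there without a
truncation.\<close>

lemma h_positive:
  assumes x0: "x0 \<in> Omega" "0 < h0 x0" and x: "x \<in> {-1..1}" and t: "t > 0"
  shows "0 < h x t"
proof -
  define \<eta> where "\<eta> = h x0 0 / 2"
  have \<eta>: "\<eta> > 0" using x0 classical_h by (auto simp: \<eta>_def classical_with_datum_def)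
  obtain r where r: "r > 0" and near: "\<And>y. y \<in> {-1..1} \<Longrightarrow> \<bar>y - x0\<bar> < r \<Longrightarrow> \<eta> \<le> h y 0"
  proof -
    obtain r where "r > 0" "\<And>y. y \<in> {-1..1} \<Longrightarrow> dist y x0 < r \<Longrightarrow> dist (h y 0) (h x0 0) < \<eta>"
      using continuous_h_slice[of 0] x0(1) \<eta> unfolding continuous_on_iff by fastforce
    moreover have "\<eta> \<le> h y 0" if "dist (h y 0) (h x0 0) < \<eta>" for y
      using that by (simp add: dist_real_def \<eta>_def abs_if split: if_splits)
    ultimately show ?thesis using that by (metis dist_real_def)
  qed
  \<comment> \<open>\<open>\<beta>\<close> makes \<open>q(-, t)\<close> positive up to distance \<open>2\<close>, the length of the interval; \<open>K\<close> is the
    smallest value for which the completed square in the subsolution inequality works.\<close>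
  define \<beta> where "\<beta> = 4 / t"
  define K where "K = (3 * \<beta> + 30)\<^sup>2 / (96 * r\<^sup>2)"
  define \<kappa> where "\<kappa> = \<eta> / (r\<^sup>2) ^ 3"
  define q where "q = (\<lambda>y s. r\<^sup>2 + \<beta> * s - (y - x0)\<^sup>2)"
  define E where "E = (\<lambda>s. \<kappa> * exp (- K * s))"
  have \<kappa>: "\<kappa> > 0" and \<beta>: "\<beta> > 0" using \<eta> r t by (auto simp: \<kappa>_def \<beta>_def)
  have E: "E s > 0" for s using \<kappa> by (simp add: E_def)
  have "E t * q x t ^ 3 - h x t \<le> 0"
  proof (rule max_principle_interval[where w = "\<lambda>x t. E t * q x t ^ 3 - h x t" and a = 0 and T = t
        and w\<^sub>x = "\<lambda>x t. E t * (3 * (q x t)\<^sup>2 * (- 2 * (x - x0))) - pd_x h x t"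
        and w\<^sub>x\<^sub>x = "\<lambda>x t. E t * (24 * q x t * (x - x0)\<^sup>2 - 6 * (q x t)\<^sup>2) - pd_x (pd_x h) x t"
        and b = "\<lambda>x t. 0"])
    have "continuous_on ({-1..1} \<times> {0..t}) (\<lambda>(x, t). h x t)"
      by (rule continuous_on_subset[OF continuous_h]) auto
    then show "continuous_on ({-1..1} \<times> {0..t}) (\<lambda>(x, t). E t * q x t ^ 3 - h x t)"
      unfolding case_prod_unfold E_def q_def by (intro continuous_intros)
  next
    fix y :: real assume y: "y \<in> {-1..1}"
    show "E 0 * q y 0 ^ 3 - h y 0 \<le> 0"
    proof (cases "\<bar>y - x0\<bar> < r")
      case True
      then have "(y - x0)\<^sup>2 \<le> r\<^sup>2" by (intro abs_le_square_iff[THEN iffD1]) auto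
      then have "q y 0 ^ 3 \<le> (r\<^sup>2) ^ 3" by (intro power_mono) (auto simp: q_def)
      then have "E 0 * q y 0 ^ 3 \<le> \<eta>" using \<kappa> r by (simp add: E_def \<kappa>_def field_simps)
      then show ?thesis using near[OF y True] by simp
    next
      case False
      then have "r\<^sup>2 \<le> (y - x0)\<^sup>2" using r by (intro abs_le_square_iff[THEN iffD1]) auto
      then have "q y 0 \<le> 0" by (simp add: q_def)
      then have "q y 0 ^ 3 \<le> 0" by (simp add: power_le_zero_eq)
      then have "E 0 * q y 0 ^ 3 \<le> 0" using E[of 0] by (simp add: mult_nonneg_nonpos)
      then show ?thesis using h_nonneg[OF y, of 0] by simp
    qed
  next
    fix y s :: real assume y: "y \<in> Omega" and s: "0 < s"
    show "((\<lambda>y. E s * q y s ^ 3 - h y s) has_real_derivative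
        E s * (3 * (q y s)\<^sup>2 * (- 2 * (y - x0))) - pd_x h y s) (at y)"
      using h_derivatives(1)[OF s, of y] y unfolding q_def
      by (auto simp: at_within_Icc_at intro!: derivative_eq_intros)
    show "((\<lambda>y. E s * (3 * (q y s)\<^sup>2 * (- 2 * (y - x0))) - pd_x h y s) has_real_derivative
        E s * (24 * q y s * (y - x0)\<^sup>2 - 6 * (q y s)\<^sup>2) - pd_x (pd_x h) y s) (at y)"
      using h_derivatives(2)[OF s, of y] y unfolding q_def
      by (auto intro!: derivative_eq_intros simp: algebra_simps power2_eq_square)
    assume "0 < E s * q y s ^ 3 - h y s"
    then have "0 < E s * q y s ^ 3" using h_nonneg[of y s] y s by auto
    then have q: "q y s > 0" using E[of s] by (simp add: zero_less_mult_iff zero_less_power_eq)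
    define Q where "Q = q y s"
    have Q: "Q > 0" using q by (simp add: Q_def)
    have yQ: "(y - x0)\<^sup>2 \<ge> r\<^sup>2 - Q" using \<beta> s by (simp add: Q_def q_def)
    \<comment> \<open>After division by \<open>Q\<close> the inequality
      \<open>3 \<beta> Q\<^sup>2 - K Q\<^sup>3 \<le> 24 Q (y - x0)\<^sup>2 - 6 Q\<^sup>2\<close> follows from this square being nonnegative, as \<open>(y - x0)\<^sup>2 \<ge> r\<^sup>2 - Q\<close>.\<close>
    have "0 \<le> 24 * (r - (3 * \<beta> + 30) * Q / (48 * r))\<^sup>2" by simp
    also have "\<dots> = 24 * r\<^sup>2 + K * Q\<^sup>2 - (3 * \<beta> + 30) * Q"
      using r by (simp add: K_def power2_eq_square field_simps)
    finally have "(3 * \<beta> - K * Q) * Q \<le> 24 * (r\<^sup>2 - Q) - 6 * Q" by (simp add: algebra_simps power2_eq_square)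
    also have "\<dots> \<le> 24 * (y - x0)\<^sup>2 - 6 * Q" using yQ by simp
    finally have "Q * ((3 * \<beta> - K * Q) * Q) \<le> Q * (24 * (y - x0)\<^sup>2 - 6 * Q)"
      using Q by (intro mult_left_mono) auto
    then have "E s * (3 * \<beta> * Q\<^sup>2 - K * Q ^ 3) \<le> E s * (24 * Q * (y - x0)\<^sup>2 - 6 * Q\<^sup>2)"
      using E[of s] by (intro mult_left_mono) (auto simp: algebra_simps power2_eq_square power3_eq_cube)
    moreover have "pd_t h y s = pd_x (pd_x h) y s"
      using heat y s by (auto simp: heat_neumann_solution_def)
    moreover have "((\<lambda>s. E s * q y s ^ 3 - h y s) has_real_derivative
        E s * (3 * \<beta> * Q\<^sup>2 - K * Q ^ 3) - pd_t h y s) (at s)"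
      using h_derivatives(3)[OF s, of y] y unfolding q_def E_def Q_def
      by (auto intro!: derivative_eq_intros simp: algebra_simps power2_eq_square power3_eq_cube)
    ultimately show "\<exists>d\<le>E s * (24 * q y s * (y - x0)\<^sup>2 - 6 * (q y s)\<^sup>2) - pd_x (pd_x h) y s +
        0 * (E s * (3 * (q y s)\<^sup>2 * (- 2 * (y - x0))) - pd_x h y s).
        ((\<lambda>s. E s * q y s ^ 3 - h y s) has_real_derivative d) (at s)"
      by (intro exI[of _ "E s * (3 * \<beta> * Q\<^sup>2 - K * Q ^ 3) - pd_t h y s"]) (auto simp: Q_def)
  next
    fix y s :: real assume y: "y \<in> {-1, 1}" and s: "0 < s" and pos: "0 < E s * q y s ^ 3 - h y s"
    have yI: "y \<in> {-1..1}" using y by auto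
    have "0 < E s * q y s ^ 3" using pos h_nonneg[OF yI, of s] s by auto
    then have q: "q y s > 0" using E[of s] by (simp add: zero_less_mult_iff zero_less_power_eq)
    have "pd_x h y s = 0" using heat y s by (auto simp: heat_neumann_solution_def)
    then have "((\<lambda>y. E s * q y s ^ 3 - h y s) has_real_derivative
        E s * (3 * (q y s)\<^sup>2 * (- 2 * (y - x0)))) (at y within {-1..1})"
      using h_derivatives(1)[OF s yI] unfolding q_def by (auto intro!: derivative_eq_intros)
    moreover have "y * (E s * (3 * (q y s)\<^sup>2 * (- 2 * (y - x0)))) < 0"
    proof -
      have "y * (y - x0) > 0" using y x0(1) by auto
      then have "6 * E s * (q y s)\<^sup>2 * (y * (y - x0)) > 0" using E[of s] q by simp
      then show ?thesis by (simp add: algebra_simps)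
    qed
    ultimately show "\<exists>d. y * d < 0 \<and> ((\<lambda>y. E s * q y s ^ 3 - h y s) has_real_derivative d)
        (at y within {-1..1})" by blast
  qed (use x t in auto)
  moreover have "q x t > 0"
  proof -
    have "\<bar>x - x0\<bar> \<le> 2" using x x0(1) by auto
    then have "(x - x0)\<^sup>2 \<le> 2\<^sup>2" by (metis abs_le_square_iff abs_numeral)
    then show ?thesis using r t by (simp add: q_def \<beta>_def add_pos_nonneg add_strict_increasing)
  qed
  then have "0 < E t * q x t ^ 3" using E[of t] by simp
  ultimately show ?thesis by linarith
qed

end

context neumann_heat
begin

lemma H_mono: "t \<ge> 0 \<Longrightarrow> mono_on {-1..1} (\<lambda>x. primitive h x t)"
  using primitive_mono_iff[of h t, OF continuous_h_slice] h_nonneg by blast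

lemma H_at_right: "t \<ge> 0 \<Longrightarrow> primitive h 1 t = primitive h 1 0"
  by (rule mass_conserved[OF h_law])

lemma continuous_H: "continuous_on ({-1..1} \<times> {0..}) (\<lambda>(x, t). primitive h x t)"
  by (rule continuous_on_primitive[OF continuous_h])

lemma h_positive_of_mass:
  assumes "0 < primitive h 1 0" "x \<in> {-1..1}" "t > 0"
  shows "0 < h x t"
proof -
  have "\<exists>x0\<in>Omega. 0 < h0 x0"
  proof (rule ccontr)
    assume "\<not> ?thesis"
    then have "integral Omega h0 = integral Omega (\<lambda>x. 0)"
      using h0_nonneg by (intro integral_cong) force
    then show False using assms(1) primitive_initial_mass[of h h0] classical_h
      by (simp add: classical_with_datum_def)
  qed
  then show ?thesis using h_positive assms by blast
qed

lemma H_strict_mono: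
  assumes "0 < primitive h 1 0" "t > 0" "x \<in> {-1..1}" "y \<in> {-1..1}" "x < y"
  shows "primitive h x t < primitive h y t"
proof (rule DERIV_pos_imp_increasing_open[OF \<open>x < y\<close>])
  have cont: "continuous_on {-1..1} (\<lambda>x. h x t)" using assms by (intro continuous_h_slice) simp
  fix z assume z: "x < z" "z < y"
  then have "z \<in> Omega" using assms by auto
  then have "((\<lambda>x. primitive h x t) has_real_derivative h z t) (at z)"
    using primitive_has_derivative_space[of h t z, OF cont] by (simp add: at_within_Icc_at)
  moreover have "0 < h z t" using \<open>z \<in> Omega\<close> assms by (intro h_positive_of_mass) auto
  ultimately show "\<exists>d. ((\<lambda>x. primitive h x t) has_real_derivative d) (at z) \<and> 0 < d" by blast
next
  have "continuous_on {-1..1} (\<lambda>x. primitive h x t)"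
    by (rule continuous_on_slice[OF continuous_H]) (use assms in simp)
  then show "continuous_on {x..y} (\<lambda>x. primitive h x t)"
    by (rule continuous_on_subset) (use assms in auto)
qed

end

section \<open>Buyers and vendors\<close>

locale market = neumann_heat "\<lambda>x. fI x + gI x" h
  for fI gI :: "real \<Rightarrow> real" and h :: "real \<Rightarrow> real \<Rightarrow> real" +
  fixes u :: "real \<Rightarrow> real \<Rightarrow> real" and \<epsilon> :: real
  assumes \<epsilon>: "0 < \<epsilon>" and system: "system_solution \<epsilon> fI gI h u"
    and fI: "\<And>x. x \<in> Omega \<Longrightarrow> 0 \<le> fI x" and gI: "\<And>x. x \<in> Omega \<Longrightarrow> 0 \<le> gI x"
begin

definition f :: "real \<Rightarrow> real \<Rightarrow> real" where "f x t = 1/2 * h x t + 1/2 * u x t"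
definition g :: "real \<Rightarrow> real \<Rightarrow> real" where "g x t = 1/2 * h x t + (-1/2) * u x t"
definition f\<^sub>x :: "real \<Rightarrow> real \<Rightarrow> real" where "f\<^sub>x x t = 1/2 * pd_x h x t + 1/2 * pd_x u x t"
definition g\<^sub>x :: "real \<Rightarrow> real \<Rightarrow> real" where "g\<^sub>x x t = 1/2 * pd_x h x t + (-1/2) * pd_x u x t"

lemma classical_u: "classical_with_datum (\<lambda>x. fI x - gI x) u"
  using system by (simp add: system_solution_def)

lemmas u_derivatives = classical_derivatives[OF classical_u]

lemma u_law: "no_flux_law u (pd_t u) (\<lambda>x t. pd_x u x t + 1 / (2 * \<epsilon>) * ((h x t)\<^sup>2 - (u x t)\<^sup>2))"
proof -
  have D: "((\<lambda>y. pd_x u y t + 1 / (2 * \<epsilon>) * ((h y t)\<^sup>2 - (u y t)\<^sup>2)) has_real_derivative pd_t u x t) (at x)"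
    if x: "x \<in> Omega" and t: "t > 0" for x t
  proof -
    define w where "w = (\<lambda>y s. (h y s)\<^sup>2 - (u y s)\<^sup>2)"
    have xI: "x \<in> {-1..1}" using x by auto
    have "((\<lambda>y. w y t) has_real_derivative 2 * h x t * pd_x h x t - 2 * u x t * pd_x u x t)
        (at x within {-1..1})"
      unfolding w_def using h_derivatives(1)[OF t xI] u_derivatives(1)[OF t xI]
      by (auto intro!: derivative_eq_intros)
    then have "(\<lambda>y. w y t) differentiable (at x within {-1..1})"
      by (auto simp: real_differentiable_def)
    then have "((\<lambda>y. w y t) has_real_derivative pd_x w x t) (at x within {-1..1})"
      by (simp add: pd_x_def vector_derivative_works has_real_derivative_iff_has_vector_derivative)
    then have "((\<lambda>y. w y t) has_real_derivative pd_x w x t) (at x)"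
      using x by (simp add: at_within_Icc_at)
    then have "((\<lambda>y. pd_x u y t + 1 / (2 * \<epsilon>) * w y t) has_real_derivative
        pd_x (pd_x u) x t + 1 / (2 * \<epsilon>) * pd_x w x t) (at x)"
      by (intro derivative_intros u_derivatives(2)[OF t x] DERIV_cmult)
    moreover have "pd_t u x t = pd_x (pd_x u) x t + 1 / (2 * \<epsilon>) * pd_x w x t"
    proof -
      have "pd_t u x t - pd_x (pd_x u) x t = 1 / (2 * \<epsilon>) * pd_x w x t"
        using system x t unfolding w_def system_solution_def by blast
      then show ?thesis by simp
    qed
    ultimately show ?thesis by (simp add: w_def)
  qed
  have J: "continuous_on {-1..1} (\<lambda>x. pd_x u x t + 1 / (2 * \<epsilon>) * ((h x t)\<^sup>2 - (u x t)\<^sup>2))"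
    if "t > 0" for t
  proof -
    have "continuous_on {-1..1} (\<lambda>x. u x t)"
      by (rule continuous_on_slice[OF classical_continuous(1)[OF classical_u]]) (use that in simp)
    then show ?thesis
      using u_derivatives(4)[OF that] continuous_h_slice[of t] that by (intro continuous_intros) auto
  qed
  have B: "pd_x u x t + 1 / (2 * \<epsilon>) * ((h x t)\<^sup>2 - (u x t)\<^sup>2) = 0"
    if "x \<in> {-1, 1}" "t > 0" for x t
  proof -
    have "- pd_x u x t = 1 / (2 * \<epsilon>) * ((h x t)\<^sup>2 - (u x t)\<^sup>2)"
      using system that unfolding system_solution_def by blast
    then show ?thesis by linarith
  qed
  show ?thesis
    unfolding no_flux_law_def
    by (intro conjI ballI allI impI classical_continuous[OF classical_u] u_derivatives(3) J D B) auto
qed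

definition f\<^sub>t :: "real \<Rightarrow> real \<Rightarrow> real" where "f\<^sub>t x t = 1/2 * pd_t h x t + 1/2 * pd_t u x t"
definition g\<^sub>t :: "real \<Rightarrow> real \<Rightarrow> real" where "g\<^sub>t x t = 1/2 * pd_t h x t + (-1/2) * pd_t u x t"

text \<open>Since \<open>h\<^sup>2 - u\<^sup>2 = 4 f g\<close>, half the sum of the laws for \<open>h\<close> and \<open>u\<close> has the flux
\<open>f\<^sub>x + f g / \<epsilon>\<close>: the buyers are transported with a drift given by the vendors.\<close>

lemma f_law: "no_flux_law f f\<^sub>t (\<lambda>x t. f\<^sub>x x t + g x t / \<epsilon> * f x t)"
proof -
  have "f = (\<lambda>x t. 1/2 * h x t + 1/2 * u x t)" "f\<^sub>t = (\<lambda>x t. 1/2 * pd_t h x t + 1/2 * pd_t u x t)"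
    by (auto simp: f_def f\<^sub>t_def fun_eq_iff)
  moreover have "(\<lambda>x t. f\<^sub>x x t + g x t / \<epsilon> * f x t) =
    (\<lambda>x t. 1/2 * pd_x h x t + 1/2 * (pd_x u x t + 1 / (2 * \<epsilon>) * ((h x t)\<^sup>2 - (u x t)\<^sup>2)))"
    using \<epsilon> by (auto simp: f_def g_def f\<^sub>x_def fun_eq_iff field_simps power2_eq_square)
  ultimately show ?thesis using no_flux_law_lincomb[OF h_law u_law, of "1/2" "1/2"] by simp
qed

lemma g_law: "no_flux_law g g\<^sub>t (\<lambda>x t. g\<^sub>x x t + (- f x t / \<epsilon>) * g x t)"
proof -
  have "g = (\<lambda>x t. 1/2 * h x t + (-1/2) * u x t)" "g\<^sub>t = (\<lambda>x t. 1/2 * pd_t h x t + (-1/2) * pd_t u x t)"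
    by (auto simp: g_def g\<^sub>t_def fun_eq_iff)
  moreover have "(\<lambda>x t. g\<^sub>x x t + (- f x t / \<epsilon>) * g x t) =
    (\<lambda>x t. 1/2 * pd_x h x t + (-1/2) * (pd_x u x t + 1 / (2 * \<epsilon>) * ((h x t)\<^sup>2 - (u x t)\<^sup>2)))"
    using \<epsilon> by (auto simp: f_def g_def g\<^sub>x_def fun_eq_iff field_simps power2_eq_square)
  ultimately show ?thesis using no_flux_law_lincomb[OF h_law u_law, of "1/2" "-1/2"] by simp
qed

lemma fg_derivatives:
  assumes x: "x \<in> Omega" and t: "t > 0"
  shows "((\<lambda>y. f y t) has_real_derivative f\<^sub>x x t) (at x)"
    and "((\<lambda>y. g y t) has_real_derivative g\<^sub>x x t) (at x)"
proof -
  have xI: "x \<in> {-1..1}" using x by auto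
  have "((\<lambda>y. h y t) has_real_derivative pd_x h x t) (at x)"
       "((\<lambda>y. u y t) has_real_derivative pd_x u x t) (at x)"
    using h_derivatives(1)[OF t xI] u_derivatives(1)[OF t xI] x by (simp_all add: at_within_Icc_at)
  then show "((\<lambda>y. f y t) has_real_derivative f\<^sub>x x t) (at x)"
    and "((\<lambda>y. g y t) has_real_derivative g\<^sub>x x t) (at x)"
    unfolding f_def g_def f\<^sub>x_def g\<^sub>x_def by (auto intro!: derivative_eq_intros)
qed

lemma continuous_f: "continuous_on ({-1..1} \<times> {0..}) (\<lambda>(x, t). f x t)"
  and continuous_g: "continuous_on ({-1..1} \<times> {0..}) (\<lambda>(x, t). g x t)"
  using f_law g_law unfolding no_flux_law_def by blast+

lemma continuous_f_slice: "t \<ge> 0 \<Longrightarrow> continuous_on {-1..1} (\<lambda>x. f x t)"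
  using continuous_on_slice[OF continuous_f] by simp

lemma continuous_g_slice: "t \<ge> 0 \<Longrightarrow> continuous_on {-1..1} (\<lambda>x. g x t)"
  using continuous_on_slice[OF continuous_g] by simp

lemma datum:
  assumes "x \<in> Omega"
  shows "f x 0 = fI x" "g x 0 = gI x"
proof -
  have "h x 0 = fI x + gI x" "u x 0 = fI x - gI x"
    using assms classical_h classical_u unfolding classical_with_datum_def by blast+
  then show "f x 0 = fI x" "g x 0 = gI x" by (simp_all add: f_def g_def field_simps)
qed

lemma f_nonneg: "0 \<le> f x t" if "x \<in> {-1..1}" "t \<ge> 0"
  by (rule drift_diffusion_nonneg[OF f_law, where w\<^sub>x = f\<^sub>x and b = "\<lambda>x t. g x t / \<epsilon>"])
    (use that fg_derivatives datum fI in simp_all)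

lemma g_nonneg: "0 \<le> g x t" if "x \<in> {-1..1}" "t \<ge> 0"
  by (rule drift_diffusion_nonneg[OF g_law, where w\<^sub>x = g\<^sub>x and b = "\<lambda>x t. - f x t / \<epsilon>"])
    (use that fg_derivatives datum gI in simp_all)

lemma f_plus_g: "f x t + g x t = h x t"
  by (simp add: f_def g_def)

lemma mass_f: "t \<ge> 0 \<Longrightarrow> primitive f 1 t = integral Omega fI"
  by (rule trans[OF mass_conserved[OF f_law] primitive_initial_mass[of f fI, OF datum(1)]])

lemma mass_g: "t \<ge> 0 \<Longrightarrow> primitive g 1 t = integral Omega gI"
  by (rule trans[OF mass_conserved[OF g_law] primitive_initial_mass[of g gI, OF datum(2)]])

lemma primitive_sum:
  assumes "x \<in> {-1..1}" "t \<ge> 0"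
  shows "primitive f x t + primitive g x t = primitive h x t"
proof -
  have sub: "{-1..x} \<subseteq> {-1..1}" using assms by auto
  have "(\<lambda>y. f y t) integrable_on {-1..x}"
    by (intro integrable_continuous_interval continuous_on_subset[OF continuous_f_slice sub]) fact
  moreover have "(\<lambda>y. g y t) integrable_on {-1..x}"
    by (intro integrable_continuous_interval continuous_on_subset[OF continuous_g_slice sub]) fact
  ultimately show ?thesis by (simp add: primitive_def integral_add[symmetric] f_plus_g)
qed

lemma primitive_f_nonneg: "0 \<le> primitive f x t" if "x \<in> {-1..1}" "t \<ge> 0"
  by (rule primitive_nonneg[OF continuous_f_slice f_nonneg]) (use that in simp_all)

text \<open>Write \<open>F\<close> and \<open>H\<close> for the cumulative masses of \<open>f\<close> and \<open>h\<close>.  The Hopf-Cole transform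
\<open>W = e\<^bsup>-F/\<epsilon>\<^esup>\<close> turns \<open>F\<^sub>t = F\<^sub>x\<^sub>x + F\<^sub>x (h - F\<^sub>x) / \<epsilon>\<close> into the linear equation
\<open>W\<^sub>t = W\<^sub>x\<^sub>x + (h / \<epsilon>) W\<^sub>x\<close>.  Constants and \<open>e\<^bsup>-H/\<epsilon>\<^esup>\<close> solve the same equation, and
\<open>e\<^bsup>-H/\<epsilon>\<^esup>\<close> plus the boundary value of \<open>W\<close> at \<open>x = 1\<close> dominates \<open>W\<close> at both ends.  The third summand
takes care of the data at time \<open>d\<close>, about which only \<open>W \<le> 1\<close> is used.  It is a supersolution
because the drift is at least \<open>c / \<epsilon>\<close>: for an exponent \<open>\<alpha>\<close> the equation leaves the margin
\<open>\<alpha> (h - 2 \<alpha>) / \<epsilon>\<^sup>2\<close>, and \<open>\<alpha> = c / 2\<close> is the largest choice that keeps it nonnegative.\<close>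

lemma hopf_cole_upper_bound:
  assumes d: "0 < d" and c: "0 < c" and hc: "\<And>x t. x \<in> {-1..1} \<Longrightarrow> t \<in> {d..T} \<Longrightarrow> c \<le> h x t"
    and xt: "x \<in> {-1..1}" "t \<in> {d..T}"
  shows "exp (- primitive f x t / \<epsilon>) \<le> exp (- primitive h x t / \<epsilon>) + exp (- integral Omega fI / \<epsilon>)
    + exp ((c/2) * (1 - x) / \<epsilon> - (c/2)\<^sup>2 * (t - d) / \<epsilon>\<^sup>2)"
proof -
  define \<alpha> where "\<alpha> = c / 2"
  define W where "W = (\<lambda>x t. exp (- primitive f x t / \<epsilon>))"
  define Z where "Z = (\<lambda>x t. exp (- primitive h x t / \<epsilon>))"
  define M where "M = exp (- integral Omega fI / \<epsilon>)"
  define S where "S = (\<lambda>x t. exp (\<alpha> * (1 - x) / \<epsilon> - (\<alpha> / \<epsilon>)\<^sup>2 * (t - d)))"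
  have \<alpha>: "\<alpha> > 0" using c by (simp add: \<alpha>_def)
  have sub: "{-1..1} \<times> {d..T} \<subseteq> {-1..1} \<times> {0..}" using d by auto
  have "W x t - Z x t - M - S x t \<le> 0"
  proof (rule max_principle_interval[where w = "\<lambda>x t. W x t - Z x t - M - S x t" and a = d and T = T
        and w\<^sub>x = "\<lambda>x t. - f x t / \<epsilon> * W x t + h x t / \<epsilon> * Z x t + \<alpha> / \<epsilon> * S x t"
        and w\<^sub>x\<^sub>x = "\<lambda>x t. (- f\<^sub>x x t / \<epsilon> + (f x t / \<epsilon>)\<^sup>2) * W x t
          + (pd_x h x t / \<epsilon> - (h x t / \<epsilon>)\<^sup>2) * Z x t - (\<alpha> / \<epsilon>)\<^sup>2 * S x t"
        and b = "\<lambda>x t. h x t / \<epsilon>"])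
    have "continuous_on ({-1..1} \<times> {d..T}) (\<lambda>p. primitive f (fst p) (snd p))"
      "continuous_on ({-1..1} \<times> {d..T}) (\<lambda>p. primitive h (fst p) (snd p))"
      using continuous_on_subset[OF continuous_on_primitive[OF continuous_f] sub]
        continuous_on_subset[OF continuous_H sub] by (simp_all add: case_prod_unfold)
    then show "continuous_on ({-1..1} \<times> {d..T}) (\<lambda>(x, t). W x t - Z x t - M - S x t)"
      unfolding case_prod_unfold W_def Z_def S_def using \<epsilon> by (intro continuous_intros) auto
  next
    fix y :: real assume y: "y \<in> {-1..1}"
    have "0 \<le> primitive f y d" by (rule primitive_f_nonneg[OF y]) (use d in simp)
    then have "W y d \<le> 1" using \<epsilon> by (simp add: W_def)
    moreover have "1 \<le> S y d" using \<alpha> \<epsilon> y by (simp add: S_def)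
    moreover have "0 < Z y d" "0 < M" by (simp_all add: Z_def M_def)
    ultimately show "W y d - Z y d - M - S y d \<le> 0" by linarith
  next
    fix y s :: real assume y: "y \<in> Omega" and s: "d < s" "s \<le> T"
    have s0: "s > 0" and yI: "y \<in> {-1..1}" using s d y by auto
    have "((\<lambda>y. primitive f y s) has_real_derivative f y s) (at y)"
      using primitive_has_derivative_space[of f s y, OF continuous_f_slice yI] s0 y
      by (simp add: at_within_Icc_at)
    moreover have "((\<lambda>y. primitive h y s) has_real_derivative h y s) (at y)"
      using primitive_has_derivative_space[of h s y, OF continuous_h_slice yI] s0 y
      by (simp add: at_within_Icc_at)
    ultimately have DW: "((\<lambda>y. W y s) has_real_derivative - f y s / \<epsilon> * W y s) (at y)"
      and DZ: "((\<lambda>y. Z y s) has_real_derivative - h y s / \<epsilon> * Z y s) (at y)"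
      and DS: "((\<lambda>y. S y s) has_real_derivative - \<alpha> / \<epsilon> * S y s) (at y)"
      unfolding W_def Z_def S_def using \<epsilon> by (auto intro!: derivative_eq_intros)
    show "((\<lambda>y. W y s - Z y s - M - S y s) has_real_derivative
        - f y s / \<epsilon> * W y s + h y s / \<epsilon> * Z y s + \<alpha> / \<epsilon> * S y s) (at y)"
      using DW DZ DS by (auto intro!: derivative_eq_intros)
    have Df: "((\<lambda>y. f y s) has_real_derivative f\<^sub>x y s) (at y)" by (rule fg_derivatives(1)[OF y s0])
    have Dh: "((\<lambda>y. h y s) has_real_derivative pd_x h y s) (at y)"
      using h_derivatives(1)[OF s0 yI] y by (simp add: at_within_Icc_at)
    have fW: "((\<lambda>y. - f y s / \<epsilon> * W y s) has_real_derivative (- f\<^sub>x y s / \<epsilon> + (f y s / \<epsilon>)\<^sup>2) * W y s) (at y)"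
      using DERIV_mult[OF DERIV_cmult[OF Df, of "- 1 / \<epsilon>"] DW]
      by (simp add: algebra_simps power2_eq_square)
    have hZ: "((\<lambda>y. h y s / \<epsilon> * Z y s) has_real_derivative (pd_x h y s / \<epsilon> - (h y s / \<epsilon>)\<^sup>2) * Z y s) (at y)"
      using DERIV_mult[OF DERIV_cmult[OF Dh, of "1 / \<epsilon>"] DZ]
      by (simp add: algebra_simps power2_eq_square)
    have aS: "((\<lambda>y. \<alpha> / \<epsilon> * S y s) has_real_derivative - (\<alpha> / \<epsilon>)\<^sup>2 * S y s) (at y)"
      using DERIV_cmult[OF DS, of "\<alpha> / \<epsilon>"] by (simp add: algebra_simps power2_eq_square)
    show "((\<lambda>y. - f y s / \<epsilon> * W y s + h y s / \<epsilon> * Z y s + \<alpha> / \<epsilon> * S y s) has_real_derivative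
        (- f\<^sub>x y s / \<epsilon> + (f y s / \<epsilon>)\<^sup>2) * W y s
          + (pd_x h y s / \<epsilon> - (h y s / \<epsilon>)\<^sup>2) * Z y s - (\<alpha> / \<epsilon>)\<^sup>2 * S y s) (at y)"
      using DERIV_add[OF DERIV_add[OF fW hZ] aS] by simp
    define Jf where "Jf = f\<^sub>x y s + g y s / \<epsilon> * f y s"
    have "((\<lambda>s. primitive f y s) has_real_derivative Jf) (at s)"
      using primitive_has_derivative_time[OF f_law yI s0] by (simp add: Jf_def)
    moreover have "((\<lambda>s. primitive h y s) has_real_derivative pd_x h y s) (at s)"
      using primitive_has_derivative_time[OF h_law yI s0] .
    ultimately have "((\<lambda>s. W y s) has_real_derivative - Jf / \<epsilon> * W y s) (at s)"
      "((\<lambda>s. Z y s) has_real_derivative - pd_x h y s / \<epsilon> * Z y s) (at s)"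
      "((\<lambda>s. S y s) has_real_derivative - (\<alpha> / \<epsilon>)\<^sup>2 * S y s) (at s)"
      unfolding W_def Z_def S_def using \<epsilon>
      by (auto intro!: derivative_eq_intros)
    then have "((\<lambda>s. W y s - Z y s - M - S y s) has_real_derivative
        - Jf / \<epsilon> * W y s + pd_x h y s / \<epsilon> * Z y s + (\<alpha> / \<epsilon>)\<^sup>2 * S y s) (at s)"
      by (auto intro!: derivative_eq_intros)
    moreover have "- Jf / \<epsilon> * W y s + pd_x h y s / \<epsilon> * Z y s + (\<alpha> / \<epsilon>)\<^sup>2 * S y s
      \<le> (- f\<^sub>x y s / \<epsilon> + (f y s / \<epsilon>)\<^sup>2) * W y s
          + (pd_x h y s / \<epsilon> - (h y s / \<epsilon>)\<^sup>2) * Z y s - (\<alpha> / \<epsilon>)\<^sup>2 * S y s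
        + h y s / \<epsilon> * (- f y s / \<epsilon> * W y s + h y s / \<epsilon> * Z y s + \<alpha> / \<epsilon> * S y s)" (is "?l \<le> ?r")
    proof -
      have h: "h y s = f y s + g y s" by (simp add: f_plus_g)
      have "?r - ?l = \<alpha> / \<epsilon>\<^sup>2 * (h y s - 2 * \<alpha>) * S y s"
        unfolding Jf_def h using \<epsilon> by (simp add: field_simps power2_eq_square)
      moreover have "0 \<le> \<alpha> / \<epsilon>\<^sup>2 * (h y s - 2 * \<alpha>) * S y s"
        using hc[OF yI, of s] s \<alpha> by (intro mult_nonneg_nonneg) (auto simp: \<alpha>_def S_def)
      ultimately show ?thesis by linarith
    qed
    ultimately show "\<exists>D\<le>(- f\<^sub>x y s / \<epsilon> + (f y s / \<epsilon>)\<^sup>2) * W y s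
          + (pd_x h y s / \<epsilon> - (h y s / \<epsilon>)\<^sup>2) * Z y s - (\<alpha> / \<epsilon>)\<^sup>2 * S y s
        + h y s / \<epsilon> * (- f y s / \<epsilon> * W y s + h y s / \<epsilon> * Z y s + \<alpha> / \<epsilon> * S y s).
      ((\<lambda>s. W y s - Z y s - M - S y s) has_real_derivative D) (at s)" by blast
  next
    fix y s :: real assume y: "y \<in> {-1, 1}" and s: "d < s" and pos: "0 < W y s - Z y s - M - S y s"
    have "W (-1) s = Z (-1) s" by (simp add: W_def Z_def)
    moreover have "W 1 s = M" using mass_f[of s] s d by (simp add: W_def M_def)
    moreover have "0 < Z y s" "0 < M" "0 < S y s" by (simp_all add: Z_def M_def S_def)
    ultimately have False using y pos by auto
    then show "\<exists>D. y * D < 0 \<and> ((\<lambda>y. W y s - Z y s - M - S y s) has_real_derivative D)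
      (at y within {-1..1})" ..
  qed (use xt in auto)
  then show ?thesis by (simp add: W_def Z_def M_def S_def \<alpha>_def power_divide)
qed

text \<open>The smallness condition ensures that at time \<open>t\<close> the transient term of the previous estimate has
dropped below \<open>e\<^bsup>-m/\<epsilon>\<^esup>\<close>, with \<open>m\<close> the total mass of the buyers; it holds for all small \<open>\<epsilon>\<close> because
that term decays like \<open>e\<^bsup>-C/\<epsilon>\<^sup>2\<^esup>\<close>.  The three summands are then at most \<open>e\<^bsup>-min(H, m)/\<epsilon>\<^esup>\<close> each, hence
the \<open>ln 3\<close>.\<close>

lemma primitive_f_lower_bound:
  assumes d: "0 < d" and c: "0 < c" and hc: "\<And>x t. x \<in> {-1..1} \<Longrightarrow> t \<in> {d..T} \<Longrightarrow> c \<le> h x t"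
    and xt: "x \<in> {-1..1}" "t \<in> {d..T}"
    and small: "\<epsilon> * (c + integral Omega fI) \<le> c\<^sup>2 * (t - d) / 4"
  shows "min (primitive h x t) (integral Omega fI) - \<epsilon> * ln 3 \<le> primitive f x t"
proof -
  define m where "m = min (primitive h x t) (integral Omega fI)"
  have "c * (1 - x) \<le> c * 2" using c xt by (intro mult_left_mono) auto
  then have "\<epsilon> * (c / 2 * (1 - x) + integral Omega fI) \<le> \<epsilon> * (c + integral Omega fI)"
    using \<epsilon> by (intro mult_left_mono) auto
  also note small
  finally have "\<epsilon> * (c / 2 * (1 - x) + integral Omega fI) / \<epsilon>\<^sup>2 \<le> (c\<^sup>2 * (t - d) / 4) / \<epsilon>\<^sup>2"
    using \<epsilon> by (intro divide_right_mono) auto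
  then have "(c/2) * (1 - x) / \<epsilon> - (c/2)\<^sup>2 * (t - d) / \<epsilon>\<^sup>2 \<le> - integral Omega fI / \<epsilon>"
    using \<epsilon> by (simp add: power2_eq_square add_divide_distrib distrib_left)
  also have "\<dots> \<le> - m / \<epsilon>" using \<epsilon> by (simp add: m_def divide_right_mono)
  finally have "exp ((c/2) * (1 - x) / \<epsilon> - (c/2)\<^sup>2 * (t - d) / \<epsilon>\<^sup>2) \<le> exp (- m / \<epsilon>)" by simp
  moreover have "exp (- primitive h x t / \<epsilon>) \<le> exp (- m / \<epsilon>)" "exp (- integral Omega fI / \<epsilon>) \<le> exp (- m / \<epsilon>)"
    using \<epsilon> by (simp_all add: m_def divide_right_mono)
  ultimately have "exp (- primitive f x t / \<epsilon>) \<le> 3 * exp (- m / \<epsilon>)"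
    using hopf_cole_upper_bound[OF d c hc xt] by linarith
  also have "\<dots> = exp (ln 3 - m / \<epsilon>)" by (simp add: exp_diff exp_minus field_simps)
  finally have "- primitive f x t / \<epsilon> \<le> ln 3 - m / \<epsilon>" by simp
  then have "\<epsilon> * (- primitive f x t / \<epsilon>) \<le> \<epsilon> * (ln 3 - m / \<epsilon>)" using \<epsilon> by (intro mult_left_mono) auto
  then show ?thesis using \<epsilon> by (simp add: m_def[symmetric] right_diff_distrib)
qed

end

section \<open>Mean square convergence\<close>

lemma square_integrable_diff:
  assumes w: "square_integrable_on A w" and v: "square_integrable_on A v"
  shows "set_integrable lebesgue A (\<lambda>z. (w z - v z)\<^sup>2)"
proof -
  define a where "a = (\<lambda>z. indicator A z *\<^sub>R w z)"
  define b where "b = (\<lambda>z. indicator A z *\<^sub>R v z)"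
  have [measurable]: "a \<in> borel_measurable lebesgue" "b \<in> borel_measurable lebesgue"
    using w v unfolding square_integrable_on_def set_borel_measurable_def a_def b_def by blast+
  have sq: "(\<lambda>z. indicator A z *\<^sub>R (w z)\<^sup>2) = (\<lambda>z. (a z)\<^sup>2)" "(\<lambda>z. indicator A z *\<^sub>R (v z)\<^sup>2) = (\<lambda>z. (b z)\<^sup>2)"
    "(\<lambda>z. indicator A z *\<^sub>R (w z - v z)\<^sup>2) = (\<lambda>z. (a z - b z)\<^sup>2)"
    by (auto simp: a_def b_def indicator_def fun_eq_iff)
  have int: "integrable lebesgue (\<lambda>z. 2 * (a z)\<^sup>2 + 2 * (b z)\<^sup>2)"
    using w v unfolding square_integrable_on_def set_integrable_def sq by (intro Bochner_Integration.integrable_add integrable_mult_right) auto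
  have "(s - t)\<^sup>2 \<le> 2 * s\<^sup>2 + 2 * t\<^sup>2" for s t :: real
    using zero_le_power2[of "s + t"] by (simp add: power2_eq_square algebra_simps)
  then have "integrable lebesgue (\<lambda>z. (a z - b z)\<^sup>2)"
    by (intro Bochner_Integration.integrable_bound[OF int]) auto
  then show ?thesis unfolding set_integrable_def sq .
qed

lemma L2_limit_unique:
  fixes w :: "'e \<Rightarrow> 'a::euclidean_space \<Rightarrow> real"
  assumes F: "F \<noteq> bot" and l: "L2_tendsto A w l F" and k: "L2_tendsto A w k F"
  shows "AE z in lebesgue. z \<in> A \<longrightarrow> k z = l z"
proof -
  define I where "I = (\<lambda>v v' :: 'a \<Rightarrow> real. set_lebesgue_integral lebesgue A (\<lambda>z. (v z - v' z)\<^sup>2))"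
  have sl: "square_integrable_on A l" and sk: "square_integrable_on A k"
    using l k unfolding L2_tendsto_def by blast+
  have "\<forall>\<^sub>F e in F. square_integrable_on A (w e)" using l unfolding L2_tendsto_def by blast
  then have "\<forall>\<^sub>F e in F. I k l \<le> 2 * I (w e) k + 2 * I (w e) l"
  proof eventually_elim
    case (elim e)
    note int = square_integrable_diff[OF elim sk] square_integrable_diff[OF elim sl]
      square_integrable_diff[OF sk sl]
    have tri: "(k z - l z)\<^sup>2 \<le> 2 * (w e z - k z)\<^sup>2 + 2 * (w e z - l z)\<^sup>2" for z
      using zero_le_power2[of "(w e z - k z) + (w e z - l z)"] by (simp add: power2_eq_square algebra_simps)
    have "I k l \<le> set_lebesgue_integral lebesgue A (\<lambda>z. 2 * (w e z - k z)\<^sup>2 + 2 * (w e z - l z)\<^sup>2)"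
      unfolding I_def by (rule set_integral_mono) (use int tri in \<open>auto intro!: set_integral_add set_integrable_mult_right\<close>)
    also have "\<dots> = 2 * I (w e) k + 2 * I (w e) l"
      unfolding I_def using int by (subst set_integral_add) (auto intro!: set_integrable_mult_right)
    finally show ?case .
  qed
  moreover have "((\<lambda>e. 2 * I (w e) k + 2 * I (w e) l) \<longlongrightarrow> 2 * 0 + 2 * 0) F"
    using l k unfolding L2_tendsto_def I_def by (intro tendsto_intros) blast+
  ultimately have I_le: "I k l \<le> 0"
    using tendsto_lowerbound[OF _ _ F] by fastforce
  have int: "integrable lebesgue (\<lambda>z. indicator A z *\<^sub>R (k z - l z)\<^sup>2)"
    using square_integrable_diff[OF sk sl] unfolding set_integrable_def .
  have "0 \<le> I k l"
    unfolding I_def set_lebesgue_integral_def by (rule Bochner_Integration.integral_nonneg) simp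
  with I_le have "I k l = 0" by linarith
  then have "AE z in lebesgue. indicator A z *\<^sub>R (k z - l z)\<^sup>2 = 0"
    using integral_nonneg_eq_0_iff_AE[OF int] unfolding I_def set_lebesgue_integral_def by simp
  then show ?thesis by eventually_elim (auto simp: indicator_def)
qed

lemma vanishing_limit_unique:
  assumes "vanishing_limit w l" "vanishing_limit w k"
  shows "ae_equal k l"
proof -
  have "AE z in lebesgue. z \<in> Omega \<times> {0<..<real (Suc n)} \<longrightarrow> (\<lambda>(x, t). k x t) z = (\<lambda>(x, t). l x t) z" for n
    using assms unfolding vanishing_limit_def
    by (intro L2_limit_unique[where F = "at_right 0" and w = "\<lambda>\<epsilon> (x, t). w \<epsilon> x t"]) auto
  then have "AE z in lebesgue. \<forall>n. z \<in> Omega \<times> {0<..<real (Suc n)} \<longrightarrow>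
      (\<lambda>(x, t). k x t) z = (\<lambda>(x, t). l x t) z"
    unfolding AE_all_countable by blast
  then show ?thesis
    unfolding ae_equal_def
  proof eventually_elim
    case (elim z)
    obtain n where "snd z < real n" using reals_Archimedean2 by blast
    then have "z \<in> Omega \<times> {0<..} \<Longrightarrow> z \<in> Omega \<times> {0<..<real (Suc n)}" by (auto simp: mem_Times_iff)
    then show ?case using elim by (auto simp: case_prod_unfold)
  qed
qed

lemma bounded_square_integrable:
  fixes w :: "'a::euclidean_space \<Rightarrow> real"
  assumes A: "A \<in> sets borel" "bounded A" and meas: "set_borel_measurable borel A w"
    and bound: "\<And>z. z \<in> A \<Longrightarrow> \<bar>w z\<bar> \<le> M"
  shows "square_integrable_on A w"
proof -
  define a where "a = (\<lambda>z. indicator A z *\<^sub>R w z)"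
  have a: "a \<in> borel_measurable lborel" using meas by (simp add: set_borel_measurable_def a_def)
  have leb: "a \<in> borel_measurable lebesgue" by (rule measurable_completion[OF a])
  have sets: "A \<in> sets lebesgue" using A by simp
  have "emeasure lebesgue A < \<infinity>" using A emeasure_bounded_finite by auto
  moreover have "norm ((a z)\<^sup>2) \<le> M\<^sup>2" if "z \<in> A" for z
    using power_mono[OF bound[OF that], of 2] that by (simp add: a_def)
  ultimately have "integrable lebesgue (\<lambda>z. indicator A z *\<^sub>R (a z)\<^sup>2)"
    using leb sets by (intro integrableI_bounded_set_indicator[where B = "M\<^sup>2"]) auto
  also have "(\<lambda>z. indicator A z *\<^sub>R (a z)\<^sup>2) = (\<lambda>z. indicator A z *\<^sub>R (w z)\<^sup>2)"
    by (auto simp: a_def indicator_def)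
  finally show ?thesis
    using leb unfolding square_integrable_on_def set_borel_measurable_def set_integrable_def a_def by blast
qed

text \<open>By Tonelli it suffices to bound the slices at fixed time.  The short interval before \<open>d\<close> carries a
crude bound, since no smallness is available in the initial layer.\<close>

lemma space_time_integral_bound:
  fixes D :: "real \<times> real \<Rightarrow> real"
  assumes meas: "set_borel_measurable borel (Omega \<times> {0<..<T}) D"
    and nonneg: "\<And>z. 0 \<le> D z" and C: "0 \<le> C\<^sub>1" "0 \<le> C\<^sub>2" and d: "0 \<le> d" and T: "0 \<le> T"
    and early: "\<And>t. \<lbrakk>0 < t; t < T; t < d\<rbrakk> \<Longrightarrow> (\<integral>\<^sup>+x. ennreal (D (x, t)) * indicator Omega x \<partial>lborel) \<le> ennreal C\<^sub>1"
    and late: "\<And>t. \<lbrakk>0 < t; t < T; d \<le> t\<rbrakk> \<Longrightarrow> (\<integral>\<^sup>+x. ennreal (D (x, t)) * indicator Omega x \<partial>lborel) \<le> ennreal C\<^sub>2"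
  shows "set_lebesgue_integral lebesgue (Omega \<times> {0<..<T}) D \<le> C\<^sub>1 * d + C\<^sub>2 * T"
proof -
  define a where "a = (\<lambda>z. indicator (Omega \<times> {0<..<T}) z *\<^sub>R D z)"
  have a: "a \<in> borel_measurable lborel" using meas by (simp add: set_borel_measurable_def a_def)
  have a_eq: "ennreal (a (x, t)) = ennreal (D (x, t)) * indicator Omega x * indicator {0<..<T} t" for x t
    by (simp add: a_def indicator_def)
  have "(\<integral>\<^sup>+z. ennreal (a z) \<partial>lborel) = (\<integral>\<^sup>+t. (\<integral>\<^sup>+x. ennreal (a (x, t)) \<partial>lborel) \<partial>lborel)"
    using lborel_pair.nn_integral_snd[of "\<lambda>z. ennreal (a z)"] a by (simp add: lborel_prod)
  also have "\<dots> \<le> (\<integral>\<^sup>+t. ennreal C\<^sub>1 * indicator {0..d} t + ennreal C\<^sub>2 * indicator {0..T} t \<partial>lborel)"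
  proof (rule nn_integral_mono)
    fix t :: real
    show "(\<integral>\<^sup>+x. ennreal (a (x, t)) \<partial>lborel) \<le> ennreal C\<^sub>1 * indicator {0..d} t + ennreal C\<^sub>2 * indicator {0..T} t"
    proof (cases "t \<in> {0<..<T}")
      case True
      then have eq: "(\<integral>\<^sup>+x. ennreal (a (x, t)) \<partial>lborel) = (\<integral>\<^sup>+x. ennreal (D (x, t)) * indicator Omega x \<partial>lborel)"
        by (simp add: a_eq)
      show ?thesis
      proof (cases "t < d")
        case td: True
        then have "(\<integral>\<^sup>+x. ennreal (a (x, t)) \<partial>lborel) \<le> ennreal C\<^sub>1" using early[of t] True eq by simp
        also have "\<dots> \<le> ennreal C\<^sub>1 * indicator {0..d} t + ennreal C\<^sub>2 * indicator {0..T} t"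
          using True td by simp
        finally show ?thesis .
      next
        case td: False
        then have "(\<integral>\<^sup>+x. ennreal (a (x, t)) \<partial>lborel) \<le> ennreal C\<^sub>2" using late[of t] True eq by simp
        also have "\<dots> \<le> ennreal C\<^sub>1 * indicator {0..d} t + ennreal C\<^sub>2 * indicator {0..T} t"
          using True by simp
        finally show ?thesis .
      qed
    next
      case False
      then show ?thesis by (simp add: a_eq)
    qed
  qed
  also have "\<dots> = ennreal C\<^sub>1 * ennreal d + ennreal C\<^sub>2 * ennreal T"
    using d T by (subst nn_integral_add) (auto simp: nn_integral_cmult_indicator)
  also have "\<dots> = ennreal (C\<^sub>1 * d + C\<^sub>2 * T)" using C d T by (simp add: ennreal_mult)
  finally have bound: "(\<integral>\<^sup>+z. ennreal (a z) \<partial>lborel) \<le> ennreal (C\<^sub>1 * d + C\<^sub>2 * T)" .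
  have "set_lebesgue_integral lebesgue (Omega \<times> {0<..<T}) D = integral\<^sup>L lborel a"
    using integral_completion[OF a] by (simp add: set_lebesgue_integral_def a_def)
  also have "\<dots> = enn2real (\<integral>\<^sup>+z. ennreal (a z) \<partial>lborel)"
    using nonneg by (intro integral_eq_nn_integral[OF a]) (auto simp: a_def)
  also have "\<dots> \<le> C\<^sub>1 * d + C\<^sub>2 * T"
    using C d T by (intro enn2real_leI[OF _ bound]) auto
  finally show ?thesis .
qed

lemma set_borel_measurable_continuous_strip:
  fixes w :: "real \<Rightarrow> real \<Rightarrow> real"
  assumes "continuous_on ({-1..1} \<times> {0..}) (\<lambda>(x, t). w x t)"
  shows "set_borel_measurable borel (Omega \<times> {0<..<T}) (\<lambda>(x, t). w x t)"
  unfolding set_borel_measurable_def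
proof (rule borel_measurable_continuous_on_indicator)
  show "continuous_on (Omega \<times> {0<..<T}) (\<lambda>(x, t). w x t)"
    by (rule continuous_on_subset[OF assms]) auto
qed (intro borel_open open_Times open_greaterThanLessThan)

lemma set_borel_measurable_square_diff:
  fixes w v :: "'a::topological_space \<Rightarrow> real"
  assumes "set_borel_measurable borel A w" "set_borel_measurable borel A v"
  shows "set_borel_measurable borel A (\<lambda>z. (w z - v z)\<^sup>2)"
proof -
  have "(\<lambda>z. (indicator A z *\<^sub>R w z - indicator A z *\<^sub>R v z)\<^sup>2) \<in> borel_measurable borel"
    using assms unfolding set_borel_measurable_def by measurable
  also have "(\<lambda>z. (indicator A z *\<^sub>R w z - indicator A z *\<^sub>R v z)\<^sup>2) = (\<lambda>z. indicator A z *\<^sub>R (w z - v z)\<^sup>2)"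
    by (auto simp: indicator_def)
  finally show ?thesis unfolding set_borel_measurable_def .
qed

section \<open>The limit of vanishing \<epsilon>\<close>

text \<open>The profile \<open>h\<close> to the left of the price and \<open>- h\<close> to the right.  Comparing the cumulative mass of
\<open>h\<close> with \<open>m\<close> instead of \<open>x\<close> with the price makes joint measurability in \<open>(x, t)\<close> immediate and
needs no choice of a price when \<open>h\<close> vanishes identically.\<close>

definition segregated :: "real \<Rightarrow> (real \<Rightarrow> real \<Rightarrow> real) \<Rightarrow> real \<Rightarrow> real \<Rightarrow> real" where
  "segregated m h x t = (if primitive h x t < m then h x t else - h x t)"

context neumann_heat
begin

lemma h_zero_of_mass:
  assumes "primitive h 1 0 = 0" "x \<in> {-1..1}" "t \<ge> 0"
  shows "h x t = 0"
proof -
  have "integral {-1..1} (\<lambda>x. h x t) = 0"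
    using H_at_right[OF assms(3)] assms(1) by (simp add: primitive_def)
  moreover have "integral {-1..1} (\<lambda>x. h x t) = 0 \<longleftrightarrow> (\<forall>x\<in>{-1..1}. h x t = 0)"
    by (rule integral_eq_0_iff[OF continuous_h_slice]) (use assms h_nonneg in auto)
  ultimately show ?thesis using assms(2) by blast
qed

lemma h_bounded:
  obtains M where "0 \<le> M" "\<And>x t. \<lbrakk>x \<in> {-1..1}; 0 \<le> t; t \<le> T\<rbrakk> \<Longrightarrow> h x t \<le> M"
proof -
  have "continuous_on ({-1..1} \<times> {0..T}) (\<lambda>(x, t). h x t)"
    by (rule continuous_on_subset[OF continuous_h]) auto
  then have "bounded ((\<lambda>(x, t). h x t) ` ({-1..1} \<times> {0..T}))"
    by (intro compact_imp_bounded compact_continuous_image compact_Times) auto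
  then obtain M where M: "\<And>p. p \<in> {-1..1} \<times> {0..T} \<Longrightarrow> norm ((\<lambda>(x, t). h x t) p) \<le> M"
    unfolding bounded_iff by blast
  have "h x t \<le> max 0 M" if "x \<in> {-1..1}" "0 \<le> t" "t \<le> T" for x t
    using M[of "(x, t)"] that by auto
  then show ?thesis using that[of "max 0 M"] by auto
qed

lemma h_positive_lower_bound:
  assumes m: "0 < primitive h 1 0" and d: "0 < d" "d \<le> T"
  obtains c where "0 < c" "\<And>x t. \<lbrakk>x \<in> {-1..1}; t \<in> {d..T}\<rbrakk> \<Longrightarrow> c \<le> h x t"
proof -
  have "continuous_on ({-1..1} \<times> {d..T}) (\<lambda>(x, t). h x t)"
    by (rule continuous_on_subset[OF continuous_h]) (use d in auto)
  moreover have "compact ({-1..1::real} \<times> {d..T})" by (intro compact_Times) auto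
  moreover have "(0, d) \<in> {-1..1::real} \<times> {d..T}" using d by auto
  ultimately obtain p where p: "p \<in> {-1..1} \<times> {d..T}"
    and min: "\<forall>q\<in>{-1..1} \<times> {d..T}. (\<lambda>(x, t). h x t) p \<le> (\<lambda>(x, t). h x t) q"
    using continuous_attains_inf[of "{-1..1} \<times> {d..T}" "\<lambda>(x, t). h x t"] by blast
  show ?thesis
  proof (rule that[of "(\<lambda>(x, t). h x t) p"])
    show "0 < (\<lambda>(x, t). h x t) p"
      using p h_positive_of_mass[OF m, of "fst p" "snd p"] d by (auto simp: case_prod_unfold)
    show "(\<lambda>(x, t). h x t) p \<le> h x t" if "x \<in> {-1..1}" "t \<in> {d..T}" for x t
      using min[rule_format, of "(x, t)"] that by simp
  qed
qed

lemma H_reaches: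
  assumes "t \<ge> 0" "0 \<le> m" "m \<le> primitive h 1 0"
  obtains q where "q \<in> {-1..1}" "primitive h q t = m"
proof -
  have "continuous_on {-1..1} (\<lambda>x. primitive h x t)"
    by (rule continuous_on_slice[OF continuous_H]) (use assms in simp)
  then have "\<exists>q. -1 \<le> q \<and> q \<le> 1 \<and> primitive h q t = m"
    using assms H_at_right[of t] by (intro IVT') auto
  then show ?thesis using that by auto
qed

lemma segregated_measurable:
  "set_borel_measurable borel (Omega \<times> {0<..<T}) (\<lambda>(x, t). segregated m h x t)"
proof -
  define A where "A = Omega \<times> {0<..<T}"
  define B where "B = A \<inter> (\<lambda>(x, t). primitive h x t) -` {..<m}"
  have sub: "A \<subseteq> {-1..1} \<times> {0..}" by (auto simp: A_def)
  \<comment> \<open>The profile equals \<open>2 * indicator B * h - h\<close> on \<open>A\<close>, with \<open>B\<close> open.\<close>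
  have "open A" unfolding A_def by (intro open_Times open_greaterThanLessThan)
  then have B: "open B"
    unfolding B_def by (intro continuous_open_preimage continuous_on_subset[OF continuous_H sub]) auto
  have "(\<lambda>z. indicator A z *\<^sub>R (\<lambda>(x, t). h x t) z) \<in> borel_measurable borel"
    using \<open>open A\<close> by (intro borel_measurable_continuous_on_indicator continuous_on_subset[OF continuous_h sub]) auto
  moreover have "(\<lambda>z. indicator B z *\<^sub>R (\<lambda>(x, t). h x t) z) \<in> borel_measurable borel"
  proof (rule borel_measurable_continuous_on_indicator)
    have "B \<subseteq> {-1..1} \<times> {0..}" using sub by (auto simp: B_def)
    then show "continuous_on B (\<lambda>(x, t). h x t)" by (rule continuous_on_subset[OF continuous_h])
  qed (use B in simp)
  ultimately have "(\<lambda>z. 2 * (indicator B z *\<^sub>R (\<lambda>(x, t). h x t) z) - indicator A z *\<^sub>R (\<lambda>(x, t). h x t) z)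
      \<in> borel_measurable borel" by simp
  also have "(\<lambda>z. 2 * (indicator B z *\<^sub>R (\<lambda>(x, t). h x t) z) - indicator A z *\<^sub>R (\<lambda>(x, t). h x t) z)
      = (\<lambda>z. indicator A z *\<^sub>R (\<lambda>(x, t). segregated m h x t) z)"
    by (auto simp: B_def segregated_def indicator_def fun_eq_iff)
  finally show ?thesis unfolding set_borel_measurable_def A_def .
qed

end

context market
begin

lemma abs_u_le: "\<bar>u x t\<bar> \<le> h x t" if "x \<in> {-1..1}" "t \<ge> 0"
  using f_nonneg[OF that] g_nonneg[OF that] by (auto simp: f_def g_def)

lemma mass_h: "primitive h 1 0 = integral Omega fI + integral Omega gI"
  using primitive_sum[of 1 0] mass_f[of 0] mass_g[of 0] by simp

lemma masses_nonneg: "0 \<le> integral Omega fI" "0 \<le> integral Omega gI"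
proof -
  show "0 \<le> integral Omega fI" using primitive_f_nonneg[of 1 0] mass_f[of 0] by simp
  have "0 \<le> primitive g 1 0"
    by (rule primitive_nonneg[OF continuous_g_slice g_nonneg]) simp_all
  then show "0 \<le> integral Omega gI" using mass_g[of 0] by simp
qed

text \<open>Left of \<open>q\<close> the error \<open>u - h\<close> is \<open>- 2 g\<close>, right of it the error \<open>u + h\<close> is \<open>2 f\<close>.  Since \<open>f\<close> and \<open>g\<close>
are bounded by \<open>M\<close>, their squares are controlled by the masses of vendors left of \<open>q\<close> and of
buyers right of \<open>q\<close>, and these two masses coincide: both equal the buyers missing left of \<open>q\<close>.\<close>

lemma slice_error:
  assumes m: "0 < primitive h 1 0" and t: "0 < t" and q: "q \<in> {-1..1}"
    and Hq: "primitive h q t = integral Omega fI"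
    and M: "\<And>x. x \<in> {-1..1} \<Longrightarrow> h x t \<le> M"
  shows "(\<integral>\<^sup>+x. ennreal ((u x t - segregated (integral Omega fI) h x t)\<^sup>2) * indicator Omega x \<partial>lborel)
    \<le> ennreal (8 * M * (integral Omega fI - primitive f q t))"
proof -
  define m where "m = integral Omega fI"
  define b where "b = (\<lambda>x. if x < q then 4 * M * g x t else 4 * M * f x t)"
  have t0: "t \<ge> 0" using t by simp
  have M0: "0 \<le> M" using M[of 0] h_nonneg[of 0 t] t0 by simp
  have mass_right: "integral {q..1} (\<lambda>x. f x t) = m - primitive f q t"
  proof -
    have "(\<lambda>x. f x t) integrable_on {-1..1}"
      by (rule integrable_continuous_interval[OF continuous_f_slice[OF t0]])
    then have "primitive f q t + integral {q..1} (\<lambda>x. f x t) = primitive f 1 t"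
      unfolding primitive_def by (rule Henstock_Kurzweil_Integration.integral_combine[rotated 2]) (use q in auto)
    then show ?thesis using mass_f[OF t0] by (simp add: m_def)
  qed
  have "((\<lambda>x. 4 * M * g x t) has_integral 4 * M * primitive g q t) {-1..q}"
    unfolding primitive_def
    by (intro has_integral_mult_right integrable_integral integrable_continuous_interval
        continuous_on_subset[OF continuous_g_slice[OF t0]]) (use q in auto)
  then have left: "(b has_integral 4 * M * primitive g q t) {-1..q}"
    using has_integral_spike_interior[of _ _ "-1" q b] by (auto simp: b_def)
  have "((\<lambda>x. 4 * M * f x t) has_integral 4 * M * (m - primitive f q t)) {q..1}"
    unfolding mass_right[symmetric]
    by (intro has_integral_mult_right integrable_integral integrable_continuous_interval
        continuous_on_subset[OF continuous_f_slice[OF t0]]) (use q in auto)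
  then have right: "(b has_integral 4 * M * (m - primitive f q t)) {q..1}"
    using has_integral_spike_interior[of _ _ q 1 b] by (auto simp: b_def)
  have "primitive g q t = m - primitive f q t"
    using primitive_sum[OF q t0] Hq by (simp add: m_def)
  then have sum: "4 * M * primitive g q t + 4 * M * (m - primitive f q t) = 8 * M * (m - primitive f q t)"
    by simp
  have int: "(b has_integral 8 * M * (m - primitive f q t)) {-1..1}"
    using has_integral_combine[OF _ _ left right] q unfolding sum by simp
  have bound: "(u x t - segregated m h x t)\<^sup>2 \<le> b x" if x: "x \<in> Omega" for x
  proof -
    have xI: "x \<in> {-1..1}" using x by auto
    note fg = f_nonneg[OF xI t0] g_nonneg[OF xI t0] f_plus_g[of x t] M[OF xI]
    have hu: "h x t = f x t + g x t" "u x t = f x t - g x t" by (simp_all add: f_def g_def)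
    have sq: "(2 * s)\<^sup>2 \<le> 4 * M * s" if "0 \<le> s" "s \<le> M" for s :: real
      using mult_right_mono[OF that(2,1)] by (simp add: power2_eq_square)
    show ?thesis
    proof (cases "x < q")
      case True
      then have "primitive h x t < m" using H_strict_mono[OF m t xI q] Hq by (simp add: m_def)
      then have "u x t - segregated m h x t = - (2 * g x t)" by (simp add: segregated_def hu)
      then have "(u x t - segregated m h x t)\<^sup>2 = (2 * g x t)\<^sup>2" by simp
      also have "\<dots> \<le> 4 * M * g x t" by (rule sq) (use fg in auto)
      finally show ?thesis using True by (simp add: b_def)
    next
      case False
      then have "primitive h q t \<le> primitive h x t"
        using monotone_onD[OF H_mono[OF t0] q xI] by simp
      then have "u x t - segregated m h x t = 2 * f x t" using Hq by (simp add: segregated_def hu m_def)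
      then have "(u x t - segregated m h x t)\<^sup>2 = (2 * f x t)\<^sup>2" by simp
      also have "\<dots> \<le> 4 * M * f x t" by (rule sq) (use fg in auto)
      finally show ?thesis using False by (simp add: b_def)
    qed
  qed
  have "(\<integral>\<^sup>+x. ennreal ((u x t - segregated m h x t)\<^sup>2) * indicator Omega x \<partial>lborel)
      \<le> (\<integral>\<^sup>+x. ennreal (b x) * indicator {-1..1} x \<partial>lborel)"
  proof (rule nn_integral_mono)
    fix x :: real
    show "ennreal ((u x t - segregated m h x t)\<^sup>2) * indicator Omega x \<le> ennreal (b x) * indicator {-1..1} x"
      using bound[of x] by (auto simp: indicator_def intro: ennreal_leI)
  qed
  also have "\<dots> = ennreal (8 * M * (m - primitive f q t))"
  proof (rule nn_integral_has_integral_lebesgue'[OF _ int])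
    show "0 \<le> b x" if "x \<in> {-1..1}" for x
      using M0 f_nonneg[OF that t0] g_nonneg[OF that t0] by (auto simp: b_def)
  qed
  finally show ?thesis by (simp add: m_def)
qed

lemma L2_error:
  assumes m: "0 < primitive h 1 0" and d: "0 < d" "d < d'" "d' \<le> T"
    and c: "0 < c" and hc: "\<And>x t. x \<in> {-1..1} \<Longrightarrow> t \<in> {d..T} \<Longrightarrow> c \<le> h x t"
    and M: "0 \<le> M" "\<And>x t. \<lbrakk>x \<in> {-1..1}; 0 \<le> t; t \<le> T\<rbrakk> \<Longrightarrow> h x t \<le> M"
    and small: "\<epsilon> * (c + integral Omega fI) \<le> c\<^sup>2 * (d' - d) / 4"
  shows "set_lebesgue_integral lebesgue (Omega \<times> {0<..<T})
      (\<lambda>z. ((\<lambda>(x, t). u x t) z - (\<lambda>(x, t). segregated (integral Omega fI) h x t) z)\<^sup>2)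
    \<le> 8 * M * primitive h 1 0 * d' + 8 * M * (\<epsilon> * ln 3) * T"
proof (rule space_time_integral_bound)
  have "set_borel_measurable borel (Omega \<times> {0<..<T}) (\<lambda>(x, t). u x t)"
    by (rule set_borel_measurable_continuous_strip[OF classical_continuous(1)[OF classical_u]])
  then show "set_borel_measurable borel (Omega \<times> {0<..<T})
      (\<lambda>z. ((\<lambda>(x, t). u x t) z - (\<lambda>(x, t). segregated (integral Omega fI) h x t) z)\<^sup>2)"
    by (rule set_borel_measurable_square_diff[OF _ segregated_measurable])
next
  fix t assume t: "0 < t" "t < T"
  obtain q where q: "q \<in> {-1..1}" "primitive h q t = integral Omega fI"
    using H_reaches[of t "integral Omega fI"] t masses_nonneg mass_h by auto
  have slice: "(\<integral>\<^sup>+x. ennreal ((u x t - segregated (integral Omega fI) h x t)\<^sup>2) * indicator Omega x \<partial>lborel)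
    \<le> ennreal (8 * M * (integral Omega fI - primitive f q t))"
    by (rule slice_error[OF m t(1) q]) (use M(2) t in simp)
  have improve: "(\<integral>\<^sup>+x. ennreal (((\<lambda>(x, t). u x t) (x, t)
        - (\<lambda>(x, t). segregated (integral Omega fI) h x t) (x, t))\<^sup>2) * indicator Omega x \<partial>lborel)
      \<le> ennreal (8 * M * k)" if "integral Omega fI - primitive f q t \<le> k" for k
  proof -
    have "8 * M * (integral Omega fI - primitive f q t) \<le> 8 * M * k"
      using that M(1) by (intro mult_left_mono) auto
    then show ?thesis using order_trans[OF slice ennreal_leI] by simp
  qed
  show "(\<integral>\<^sup>+x. ennreal (((\<lambda>(x, t). u x t) (x, t)
        - (\<lambda>(x, t). segregated (integral Omega fI) h x t) (x, t))\<^sup>2) * indicator Omega x \<partial>lborel)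
      \<le> ennreal (8 * M * primitive h 1 0)"
  proof (rule improve)
    have "0 \<le> primitive f q t" using primitive_f_nonneg[OF q(1)] t by simp
    then show "integral Omega fI - primitive f q t \<le> primitive h 1 0" using mass_h masses_nonneg by simp
  qed
  show "(\<integral>\<^sup>+x. ennreal (((\<lambda>(x, t). u x t) (x, t)
        - (\<lambda>(x, t). segregated (integral Omega fI) h x t) (x, t))\<^sup>2) * indicator Omega x \<partial>lborel)
      \<le> ennreal (8 * M * (\<epsilon> * ln 3))" if "d' \<le> t"
  proof (rule improve)
    have td: "t \<in> {d..T}" using that d t by auto
    have "c\<^sup>2 * (d' - d) / 4 \<le> c\<^sup>2 * (t - d) / 4" using that by (simp add: mult_left_mono)
    then have "\<epsilon> * (c + integral Omega fI) \<le> c\<^sup>2 * (t - d) / 4" using small by linarith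
    from primitive_f_lower_bound[OF d(1) c hc q(1) td this]
    show "integral Omega fI - primitive f q t \<le> \<epsilon> * ln 3" using q(2) by simp
  qed
qed (use d M(1) \<epsilon> m in auto)

lemma system_square_integrable:
  assumes M: "\<And>x t. \<lbrakk>x \<in> {-1..1}; 0 \<le> t; t \<le> T\<rbrakk> \<Longrightarrow> h x t \<le> M"
  shows "square_integrable_on (Omega \<times> {0<..<T}) (\<lambda>(x, t). u x t)"
proof (rule bounded_square_integrable)
  show "set_borel_measurable borel (Omega \<times> {0<..<T}) (\<lambda>(x, t). u x t)"
    by (rule set_borel_measurable_continuous_strip[OF classical_continuous(1)[OF classical_u]])
  show "\<bar>(\<lambda>(x, t). u x t) z\<bar> \<le> M" if "z \<in> Omega \<times> {0<..<T}" for z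
    using abs_u_le[of "fst z" "snd z"] M[of "fst z" "snd z"] that by (auto simp: case_prod_unfold mem_Times_iff)
  show "bounded (Omega \<times> {0<..<T})" by (intro bounded_Times) auto
qed (intro borel_open open_Times open_greaterThanLessThan)

end

lemma pd_x_cong:
  assumes "\<And>y. y \<in> {-1..1} \<Longrightarrow> v y t = w y t" "x \<in> {-1..1}"
  shows "pd_x v x t = pd_x w x t"
  unfolding pd_x_def by (rule vector_derivative_cong_eq) (use assms in auto)

text \<open>Uniqueness for the heat equation allows one function \<open>h\<close> to be used for every \<open>\<epsilon>\<close>.\<close>

lemma system_solution_replace_h:
  assumes sys: "system_solution \<epsilon> fI gI k u" and h: "heat_neumann_solution (\<lambda>x. fI x + gI x) h"
  shows "system_solution \<epsilon> fI gI h u"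
proof -
  have k: "heat_neumann_solution (\<lambda>x. fI x + gI x) k" using sys by (simp add: system_solution_def)
  have eq: "k x t = h x t" if "x \<in> {-1..1}" "t > 0" for x t
    using heat_unique[OF k h that(1)] that(2) by simp
  have "pd_x (\<lambda>y s. (k y s)\<^sup>2 - (u y s)\<^sup>2) x t = pd_x (\<lambda>y s. (h y s)\<^sup>2 - (u y s)\<^sup>2) x t"
    if "x \<in> Omega" "t > 0" for x t
    by (rule pd_x_cong) (use eq that in auto)
  moreover have "k x t = h x t" if "x \<in> {-1, 1}" "t > 0" for x t
    using eq that by auto
  ultimately show ?thesis
    using sys h by (simp add: system_solution_def)
qed

lemma vanishing_limitI:
  assumes "\<And>T. 0 < T \<Longrightarrow> L2_tendsto (Omega \<times> {0<..<T}) (\<lambda>\<epsilon> (x, t). w \<epsilon> x t) (\<lambda>(x, t). l x t) (at_right 0)"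
  shows "vanishing_limit w l"
  using assms by (simp add: vanishing_limit_def)

text \<open>Given a tolerance, a short initial time interval \<open>(0, d')\<close> contributes at most a
multiple of \<open>d'\<close>; on the rest \<open>h\<close> is bounded below by some \<open>c > 0\<close> and the misplaced mass is at most
\<open>\<epsilon> ln 3\<close> once \<open>\<epsilon>\<close> is small.  Without any mass everything vanishes.\<close>

lemma system_converges:
  assumes mk: "\<And>\<epsilon>. 0 < \<epsilon> \<Longrightarrow> market fI gI h (u \<epsilon>) \<epsilon>"
  shows "vanishing_limit u (segregated (integral Omega fI) h)"
proof (rule vanishing_limitI)
  fix T :: real assume T: "0 < T"
  interpret market fI gI h "u 1" 1 by (rule mk) simp
  define m where "m = integral Omega fI"
  define A where "A = Omega \<times> {0<..<T}"
  define I where "I = (\<lambda>\<epsilon>. set_lebesgue_integral lebesgue A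
    (\<lambda>z. ((\<lambda>(x, t). u \<epsilon> x t) z - (\<lambda>(x, t). segregated m h x t) z)\<^sup>2))"
  obtain M where M: "0 \<le> M" "\<And>x t. \<lbrakk>x \<in> {-1..1}; 0 \<le> t; t \<le> T\<rbrakk> \<Longrightarrow> h x t \<le> M"
    using h_bounded by blast
  have sq: "square_integrable_on A (\<lambda>(x, t). u \<epsilon> x t)" if "0 < \<epsilon>" for \<epsilon>
    unfolding A_def by (rule market.system_square_integrable[OF mk[OF that]]) (rule M(2))
  have sql: "square_integrable_on A (\<lambda>(x, t). segregated m h x t)"
    unfolding A_def
  proof (rule bounded_square_integrable[OF _ _ segregated_measurable])
    show "\<bar>(\<lambda>(x, t). segregated m h x t) z\<bar> \<le> M" if "z \<in> Omega \<times> {0<..<T}" for z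
      using M(2)[of "fst z" "snd z"] h_nonneg[of "fst z" "snd z"] that
      by (auto simp: segregated_def case_prod_unfold mem_Times_iff)
    show "bounded (Omega \<times> {0<..<T})" by (intro bounded_Times) auto
  qed (intro borel_open open_Times open_greaterThanLessThan)
  have I_nonneg: "0 \<le> I \<epsilon>" for \<epsilon>
    unfolding I_def set_lebesgue_integral_def by (rule Bochner_Integration.integral_nonneg) simp
  have pos: "\<forall>\<^sub>F \<epsilon> in at_right (0::real). 0 < \<epsilon>" by (rule eventually_at_right_less)
  have "(I \<longlongrightarrow> 0) (at_right 0)"
  proof (cases "0 < primitive h 1 0")
    case False
    have "mono_on {-1..1} (\<lambda>x. primitive h x 0)" by (rule H_mono) simp
    then have "primitive h (-1) 0 \<le> primitive h 1 0" by (rule monotone_onD) auto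
    then have "primitive h 1 0 = 0" using False by simp
    then have h0: "h x t = 0" if "x \<in> {-1..1}" "t \<ge> 0" for x t using h_zero_of_mass that by blast
    have "I \<epsilon> = 0" if "0 < \<epsilon>" for \<epsilon>
    proof -
      have zero: "indicator A z *\<^sub>R ((\<lambda>(x, t). u \<epsilon> x t) z - (\<lambda>(x, t). segregated m h x t) z)\<^sup>2 = 0" for z
        using market.abs_u_le[OF mk[OF that], of "fst z" "snd z"] h0[of "fst z" "snd z"]
        by (cases z) (auto simp: A_def segregated_def indicator_def)
      then show ?thesis unfolding I_def set_lebesgue_integral_def
        by (simp only: zero Bochner_Integration.integral_zero)
    qed
    then have "\<forall>\<^sub>F \<epsilon> in at_right 0. I \<epsilon> = 0" using pos by (rule eventually_mono[rotated])
    then show ?thesis by (rule tendsto_eventually)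
  next
    case True
    show ?thesis
    proof (rule tendstoI)
      fix \<eta> :: real assume \<eta>: "0 < \<eta>"
      \<comment> \<open>The \<open>+ 1\<close> keeps the divisor below positive when \<open>M = 0\<close>.\<close>
      define C where "C = 8 * M * primitive h 1 0 + 1"
      have C: "C > 0" using M(1) True by (simp add: C_def add_nonneg_pos)
      define d' where "d' = min T (\<eta> / (2 * C))"
      have d': "0 < d'" "d' \<le> T" "C * d' \<le> \<eta> / 2"
      proof -
        have "C * d' \<le> C * (\<eta> / (2 * C))" using C by (intro mult_left_mono) (auto simp: d'_def)
        then show "C * d' \<le> \<eta> / 2" using C by simp
      qed (use T \<eta> C in \<open>auto simp: d'_def\<close>)
      have dT: "0 < d' / 2" "d' / 2 \<le> T" using d' by auto
      obtain c where c: "0 < c" "\<And>x t. \<lbrakk>x \<in> {-1..1}; t \<in> {d'/2..T}\<rbrakk> \<Longrightarrow> c \<le> h x t"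
        using h_positive_lower_bound[OF True dT] by blast
      have "((\<lambda>\<epsilon>. \<epsilon> * (c + m)) \<longlongrightarrow> 0 * (c + m)) (at_right 0)" by (intro tendsto_intros)
      moreover have "0 * (c + m) < c\<^sup>2 * (d' - d'/2) / 4" using c(1) d' by simp
      ultimately have small: "\<forall>\<^sub>F \<epsilon> in at_right 0. \<epsilon> * (c + m) < c\<^sup>2 * (d' - d'/2) / 4"
        by (rule order_tendstoD)
      have "((\<lambda>\<epsilon>. 8 * M * (\<epsilon> * ln 3) * T) \<longlongrightarrow> 8 * M * (0 * ln 3) * T) (at_right 0)"
        by (intro tendsto_intros)
      then have small': "\<forall>\<^sub>F \<epsilon> in at_right 0. 8 * M * (\<epsilon> * ln 3) * T < \<eta> / 2"
        by (rule order_tendstoD) (use \<eta> in simp)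
      show "\<forall>\<^sub>F \<epsilon> in at_right 0. dist (I \<epsilon>) 0 < \<eta>"
        using pos small small'
      proof eventually_elim
        case (elim \<epsilon>)
        have "I \<epsilon> \<le> 8 * M * primitive h 1 0 * d' + 8 * M * (\<epsilon> * ln 3) * T"
          unfolding I_def A_def m_def
          by (rule market.L2_error[OF mk[OF elim(1)] True dT(1) _ d'(2) c M])
            (use d'(1) elim(2) in \<open>auto simp: m_def\<close>)
        also have "8 * M * primitive h 1 0 * d' < C * d'" using d'(1) by (simp add: C_def algebra_simps)
        finally have "I \<epsilon> < \<eta>" using d'(3) elim(3) by linarith
        then show ?case using I_nonneg[of \<epsilon>] by simp
      qed
    qed
  qed
  moreover have "\<forall>\<^sub>F \<epsilon> in at_right 0. square_integrable_on A (\<lambda>(x, t). u \<epsilon> x t)"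
    using pos by (rule eventually_mono) (rule sq)
  ultimately show "L2_tendsto (Omega \<times> {0<..<T}) (\<lambda>\<epsilon> (x, t). u \<epsilon> x t)
      (\<lambda>(x, t). segregated (integral Omega fI) h x t) (at_right 0)"
    unfolding L2_tendsto_def using sql unfolding I_def A_def m_def by simp
qed

lemma heat_family_converges:
  assumes h: "heat_neumann_solution h0 h" and nonneg: "\<And>x. x \<in> Omega \<Longrightarrow> 0 \<le> h0 x"
    and k: "\<And>\<epsilon>. 0 < \<epsilon> \<Longrightarrow> heat_neumann_solution h0 (k \<epsilon>)"
  shows "vanishing_limit k h"
proof (rule vanishing_limitI)
  fix T :: real
  interpret neumann_heat h0 h using h nonneg by unfold_locales
  define A where "A = Omega \<times> {0<..<T}"
  obtain M where M: "0 \<le> M" "\<And>x t. \<lbrakk>x \<in> {-1..1}; 0 \<le> t; t \<le> T\<rbrakk> \<Longrightarrow> h x t \<le> M"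
    using h_bounded by blast
  have sq: "square_integrable_on A (\<lambda>(x, t). h x t)"
    unfolding A_def
  proof (rule bounded_square_integrable[OF _ _ set_borel_measurable_continuous_strip[OF continuous_h]])
    show "\<bar>(\<lambda>(x, t). h x t) z\<bar> \<le> M" if "z \<in> Omega \<times> {0<..<T}" for z
      using M(2)[of "fst z" "snd z"] h_nonneg[of "fst z" "snd z"] that
      by (auto simp: case_prod_unfold mem_Times_iff)
    show "bounded (Omega \<times> {0<..<T})" by (intro bounded_Times) auto
  qed (intro borel_open open_Times open_greaterThanLessThan)
  have pos: "\<forall>\<^sub>F \<epsilon> in at_right (0::real). 0 < \<epsilon>" by (rule eventually_at_right_less)
  have eq: "indicator A z *\<^sub>R (\<lambda>(x, t). k \<epsilon> x t) z = indicator A z *\<^sub>R (\<lambda>(x, t). h x t) z"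
    "indicator A z *\<^sub>R ((\<lambda>(x, t). k \<epsilon> x t) z)\<^sup>2 = indicator A z *\<^sub>R ((\<lambda>(x, t). h x t) z)\<^sup>2"
    "indicator A z *\<^sub>R ((\<lambda>(x, t). k \<epsilon> x t) z - (\<lambda>(x, t). h x t) z)\<^sup>2 = 0" if "0 < \<epsilon>" for \<epsilon> z
    using heat_unique[OF k[OF that] h, of "fst z" "snd z"]
    by (cases z; auto simp: A_def indicator_def)+
  have "square_integrable_on A (\<lambda>(x, t). k \<epsilon> x t)" if "0 < \<epsilon>" for \<epsilon>
    using sq unfolding square_integrable_on_def set_borel_measurable_def set_integrable_def
    by (simp only: eq(1,2)[OF that])
  then have "\<forall>\<^sub>F \<epsilon> in at_right 0. square_integrable_on A (\<lambda>(x, t). k \<epsilon> x t)"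
    using pos by (rule eventually_mono[rotated])
  moreover have "set_lebesgue_integral lebesgue A (\<lambda>z. ((\<lambda>(x, t). k \<epsilon> x t) z - (\<lambda>(x, t). h x t) z)\<^sup>2) = 0"
    if "0 < \<epsilon>" for \<epsilon>
    unfolding set_lebesgue_integral_def by (simp only: eq(3)[OF that] Bochner_Integration.integral_zero)
  then have "((\<lambda>\<epsilon>. set_lebesgue_integral lebesgue A
      (\<lambda>z. ((\<lambda>(x, t). k \<epsilon> x t) z - (\<lambda>(x, t). h x t) z)\<^sup>2)) \<longlongrightarrow> 0) (at_right 0)"
    by (intro tendsto_eventually eventually_mono[OF pos])
  ultimately show "L2_tendsto (Omega \<times> {0<..<T}) (\<lambda>\<epsilon> (x, t). k \<epsilon> x t) (\<lambda>(x, t). h x t) (at_right 0)"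
    unfolding L2_tendsto_def using sq unfolding A_def by simp
qed

theorem theorem3p5:
  fixes fI gI :: "real \<Rightarrow> real"
    and h\<epsilon> u\<epsilon> :: "real \<Rightarrow> real \<Rightarrow> real \<Rightarrow> real"
    and m\<^sub>f m\<^sub>g :: real
  assumes fI: "fI \<in> S_Omega" "\<forall>x\<in>Omega. 0 \<le> fI x"
    and gI: "gI \<in> S_Omega" "\<forall>x\<in>Omega. 0 \<le> gI x"
    and masses: "m\<^sub>f = integral Omega fI" "m\<^sub>g = integral Omega gI"
    and sol: "\<forall>\<epsilon>>0. system_solution \<epsilon> fI gI (h\<epsilon> \<epsilon>) (u\<epsilon> \<epsilon>)"
  shows "\<exists>h u.
    vanishing_limit h\<epsilon> h \<and> vanishing_limit u\<epsilon> u \<and>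
    (\<forall>h' u'. vanishing_limit h\<epsilon> h' \<and> vanishing_limit u\<epsilon> u' \<longrightarrow> ae_equal h' h \<and> ae_equal u' u) \<and>
    heat_neumann_solution (\<lambda>x. fI x + gI x) h \<and>
    (\<forall>h'. heat_neumann_solution (\<lambda>x. fI x + gI x) h' \<longrightarrow> (\<forall>x\<in>{-1..1}. \<forall>t\<ge>0. h' x t = h x t)) \<and>
    (\<forall>t>0. \<forall>q\<in>{-1..1}. m\<^sub>f = integral {-1..q} (\<lambda>x. h x t) \<longleftrightarrow> m\<^sub>g = integral {q..1} (\<lambda>x. h x t)) \<and>
    (\<forall>t>0. \<exists>q\<in>{-1..1}. m\<^sub>f = integral {-1..q} (\<lambda>x. h x t)) \<and>
    (m\<^sub>f + m\<^sub>g > 0 \<longrightarrow> (\<forall>t>0. \<exists>!q. q \<in> {-1..1} \<and> m\<^sub>f = integral {-1..q} (\<lambda>x. h x t))) \<and>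
    (\<forall>p. (\<forall>t>0. p t \<in> {-1..1} \<and> m\<^sub>f = integral {-1..p t} (\<lambda>x. h x t)) \<longrightarrow>
         (\<forall>x\<in>Omega. \<forall>t>0. (x < p t \<longrightarrow> u x t = h x t) \<and> (x > p t \<longrightarrow> u x t = - h x t)))"
proof -
  define h where "h = h\<epsilon> 1"
  have heats: "heat_neumann_solution (\<lambda>x. fI x + gI x) (h\<epsilon> \<epsilon>)" if "0 < \<epsilon>" for \<epsilon>
    using sol that by (simp add: system_solution_def)
  have heat: "heat_neumann_solution (\<lambda>x. fI x + gI x) h" unfolding h_def by (rule heats) simp
  have sum_nonneg: "0 \<le> fI x + gI x" if "x \<in> Omega" for x using fI(2) gI(2) that by fastforce
  have mk: "market fI gI h (u\<epsilon> \<epsilon>) \<epsilon>" if "0 < \<epsilon>" for \<epsilon>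
    using that heat sum_nonneg fI(2) gI(2) system_solution_replace_h[OF _ heat] sol
    by unfold_locales blast+
  interpret market fI gI h "u\<epsilon> 1" 1 by (rule mk) simp
  define u where "u = segregated m\<^sub>f h"
  have lim_h: "vanishing_limit h\<epsilon> h" by (rule heat_family_converges[OF heat sum_nonneg heats])
  have lim_u: "vanishing_limit u\<epsilon> u" unfolding u_def masses by (rule system_converges[OF mk])
  have H: "integral {-1..q} (\<lambda>x. h x t) = primitive h q t" for q t by (simp add: primitive_def)
  have total: "primitive h 1 t = m\<^sub>f + m\<^sub>g" if "0 \<le> t" for t
    using H_at_right[OF that] mass_h masses by simp
  have m0: "0 \<le> m\<^sub>f" "0 \<le> m\<^sub>g"
    unfolding masses by (rule masses_nonneg)+
  have right: "integral {q..1} (\<lambda>x. h x t) = m\<^sub>f + m\<^sub>g - primitive h q t" if "t > 0" "q \<in> {-1..1}" for q t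
  proof -
    have "(\<lambda>x. h x t) integrable_on {-1..1}"
      by (intro integrable_continuous_interval continuous_h_slice) (use that in simp)
    then have "primitive h q t + integral {q..1} (\<lambda>x. h x t) = primitive h 1 t"
      unfolding primitive_def
      by (rule Henstock_Kurzweil_Integration.integral_combine[rotated 2]) (use that in auto)
    then show ?thesis using total[of t] that by simp
  qed
  have ex: "\<exists>q\<in>{-1..1}. m\<^sub>f = primitive h q t" if "t > 0" for t
    using H_reaches[of t m\<^sub>f] that m0 total[of 0] by (metis add_increasing2 order_refl less_imp_le)
  have strict: "primitive h x t < primitive h y t"
    if "m\<^sub>f + m\<^sub>g > 0" "t > 0" "x \<in> {-1..1}" "y \<in> {-1..1}" "x < y" for x y t
    using H_strict_mono[of t x y] that total[of 0] by simp
  have uniq: "\<exists>!q. q \<in> {-1..1} \<and> m\<^sub>f = primitive h q t" if "m\<^sub>f + m\<^sub>g > 0" "t > 0" for t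
    using ex[OF that(2)] strict[OF that] by (metis less_irrefl linorder_neqE_linordered_idom)
  have profile: "(x < p t \<longrightarrow> u x t = h x t) \<and> (x > p t \<longrightarrow> u x t = - h x t)"
    if p: "\<forall>t>0. p t \<in> {-1..1} \<and> m\<^sub>f = primitive h (p t) t" and x: "x \<in> Omega" and t: "t > 0" for p x t
  proof (cases "m\<^sub>f + m\<^sub>g > 0")
    case True
    have xI: "x \<in> {-1..1}" using x by auto
    have "primitive h x t < m\<^sub>f" if "x < p t" using strict[OF True t xI, of "p t"] p t that by auto
    moreover have "m\<^sub>f < primitive h x t" if "x > p t" using strict[OF True t _ xI, of "p t"] p t that by auto
    ultimately show ?thesis by (auto simp: u_def segregated_def)
  next
    case False
    then have "primitive h 1 0 = 0" using total[of 0] m0 by simp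
    then have "h x t = 0" using h_zero_of_mass[of x t] x t by auto
    then show ?thesis by (simp add: u_def segregated_def)
  qed
  show ?thesis
  proof (rule exI[of _ h], rule exI[of _ u], intro conjI)
    show "\<forall>h' u'. vanishing_limit h\<epsilon> h' \<and> vanishing_limit u\<epsilon> u' \<longrightarrow> ae_equal h' h \<and> ae_equal u' u"
      using vanishing_limit_unique lim_h lim_u by blast
    show "\<forall>h'. heat_neumann_solution (\<lambda>x. fI x + gI x) h' \<longrightarrow> (\<forall>x\<in>{-1..1}. \<forall>t\<ge>0. h' x t = h x t)"
      using heat_unique[OF _ heat] by blast
    show "\<forall>t>0. \<forall>q\<in>{-1..1}. m\<^sub>f = integral {-1..q} (\<lambda>x. h x t) \<longleftrightarrow> m\<^sub>g = integral {q..1} (\<lambda>x. h x t)"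
      unfolding H using right by auto
    show "\<forall>t>0. \<exists>q\<in>{-1..1}. m\<^sub>f = integral {-1..q} (\<lambda>x. h x t)" unfolding H using ex by blast
    show "m\<^sub>f + m\<^sub>g > 0 \<longrightarrow> (\<forall>t>0. \<exists>!q. q \<in> {-1..1} \<and> m\<^sub>f = integral {-1..q} (\<lambda>x. h x t))"
      unfolding H using uniq by blast
    show "\<forall>p. (\<forall>t>0. p t \<in> {-1..1} \<and> m\<^sub>f = integral {-1..p t} (\<lambda>x. h x t)) \<longrightarrow>
         (\<forall>x\<in>Omega. \<forall>t>0. (x < p t \<longrightarrow> u x t = h x t) \<and> (x > p t \<longrightarrow> u x t = - h x t))"
      unfolding H using profile by blast
  qed (fact lim_h lim_u heat)+
qed

end
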